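(* Let $A\in\mathbb{R}^{m\times n}$, $b\in\mathbb{R}^m$ with the linear system $Ax=b$ consistent, let $r=\operatorname{rank}(A)$ and $1\le s\le r$. Let $x^0\in\mathbb{R}^n$ be arbitrary and let $\{x^k\}_{k\ge0}$ be generated by $$x^{k+1}=x^k-A_{\mathcal{S}_k}^\dagger(A_{\mathcal{S}_k}x^k-b_{\mathcal{S}_k}),$$ where at each iteration $\mathcal{S}_k\sim\operatorname{Vol}_s(AA^\top)$ is drawn independently of the past. Let $x^0_*:=A^\dagger b+(I-A^\dagger A)x^0$. Then for all $k\ge 0$, $$\big\|\mathbb{E}[x^k-x^0_*]\big\|_2^2\le(1-\rho_{A,s})^{2k}\|x^0-x^0_*\|_2^2,\qquad \rho_{A,s}:=\frac{\sigma_{\min}^2(A)}{\sigma_s^2(A)+\cdots+\sigma_{\min}^2(A)}.$$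
   Context: $\sigma_1(A)\ge\cdots\ge\sigma_r(A)=:\sigma_{\min}(A)>0$ are the nonzero singular values of $A$. For $\mathcal{S}\subseteq[m]$, $A_{\mathcal{S}}$ and $b_{\mathcal{S}}$ are the row submatrix of $A$ and subvector of $b$ indexed by $\mathcal{S}$, and $\dagger$ denotes the Moore–Penrose pseudoinverse. Volume sampling: $\mathcal{S}\sim\operatorname{Vol}_s(AA^\top)$ means $\mathcal{S}$ takes values in the $s$-element subsets of $[m]$ with $\mathbb{P}(\mathcal{S}=\mathcal{T})=\det(A_{\mathcal{T}}A_{\mathcal{T}}^\top)/\sum_{|\mathcal{J}|=s}\det(A_{\mathcal{J}}A_{\mathcal{J}}^\top)$. *)

theory Defs
  imports "Jordan_Normal_Form.Jordan_Normal_Form" "Jordan_Normal_Form.DL_Rank"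
    "Jordan_Normal_Form.DL_Submatrix" "HOL-Library.Multiset"
begin

definition is_pinv :: "real mat \<Rightarrow> real mat \<Rightarrow> bool" where
  "is_pinv A X \<longleftrightarrow> X \<in> carrier_mat (dim_col A) (dim_row A) \<and>
     A * X * A = A \<and> X * A * X = X \<and>
     transpose_mat (A * X) = A * X \<and> transpose_mat (X * A) = X * A"

definition pinv :: "real mat \<Rightarrow> real mat" where
  "pinv A = (THE X. is_pinv A X)"

definition mat_rank :: "real mat \<Rightarrow> nat" where
  "mat_rank A = vec_space.rank (dim_row A) A"

definition row_sub :: "real mat \<Rightarrow> nat set \<Rightarrow> real mat" where
  "row_sub A S = submatrix A S {0..<dim_col A}"

definition vec_sub :: "real vec \<Rightarrow> nat set \<Rightarrow> real vec" where
  "vec_sub b S = vec (card {i. i < dim_vec b \<and> i \<in> S}) (\<lambda>i. b $ pick S i)"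

text \<open>Squared singular values in non-increasing order: the eigenvalues of A^T A
  (roots of its characteristic polynomial, with multiplicity), sorted descendingly.
  sing_sq A i is sigma_(i+1)(A)^2 (0-based index).\<close>
definition sing_sq :: "real mat \<Rightarrow> nat \<Rightarrow> real" where
  "sing_sq A i = rev (sorted_list_of_multiset (proots (char_poly (transpose_mat A * A)))) ! i"

definition rho :: "real mat \<Rightarrow> nat \<Rightarrow> real" where
  "rho A s = sing_sq A (mat_rank A - 1) / (\<Sum>i = s - 1 ..< mat_rank A. sing_sq A i)"

definition subsets_s :: "nat \<Rightarrow> nat \<Rightarrow> nat set set" where
  "subsets_s m s = {J. J \<subseteq> {0..<m} \<and> card J = s}"

definition vol_prob :: "real mat \<Rightarrow> nat \<Rightarrow> nat set \<Rightarrow> real" where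
  "vol_prob A s T =
     det (row_sub A T * transpose_mat (row_sub A T)) /
     (\<Sum>J \<in> subsets_s (dim_row A) s. det (row_sub A J * transpose_mat (row_sub A J)))"

definition bk_step :: "real mat \<Rightarrow> real vec \<Rightarrow> nat set \<Rightarrow> real vec \<Rightarrow> real vec" where
  "bk_step A b S x = x - pinv (row_sub A S) *\<^sub>v (row_sub A S *\<^sub>v x - vec_sub b S)"

definition bk_iter :: "real mat \<Rightarrow> real vec \<Rightarrow> real vec \<Rightarrow> nat set list \<Rightarrow> real vec" where
  "bk_iter A b x0 Ss = fold (bk_step A b) Ss x0"

text \<open>Expectation of x^k - y when S_0,...,S_{k-1} are i.i.d. Vol_s(A A^T):
  the joint law of the sample sequence is the product measure.\<close>
definition expected_err :: "real mat \<Rightarrow> real vec \<Rightarrow> nat \<Rightarrow> real vec \<Rightarrow> nat \<Rightarrow> real vec \<Rightarrow> real vec" where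
  "expected_err A b s x0 k y = vec (dim_vec x0) (\<lambda>j.
     \<Sum>Ss \<in> {Ss. length Ss = k \<and> set Ss \<subseteq> subsets_s (dim_row A) s}.
        (\<Prod>T \<leftarrow> Ss. vol_prob A s T) * (bk_iter A b x0 Ss - y) $ j)"

end

theory Submission
  imports Defs "Jordan_Normal_Form.Schur_Decomposition"
begin

text \<open>One step maps the error \<open>x - x\<^sub>*\<close> to \<open>(I - P\<^sub>S) (x - x\<^sub>*)\<close>, where \<open>P\<^sub>S\<close> is the orthogonal
  projection onto the row space of \<open>A\<^sub>S\<close>, so the mean error after \<open>k\<close> steps is
  \<open>(I - E P\<^sub>S)\<^sup>k (x\<^sup>0 - x\<^sub>*)\<close>. Since
  \<open>det (A\<^sub>S (I + x x\<^sup>T) A\<^sub>S\<^sup>T) = det (A\<^sub>S A\<^sub>S\<^sup>T) (1 + x \<bullet> P\<^sub>S x)\<close> and sums of principal minors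
  of \<open>X Y\<close> and \<open>Y X\<close> agree, the quadratic form of \<open>E P\<^sub>S\<close> is diagonal in a basis of right
  singular vectors, with eigenvalues
  \<open>\<lambda>\<^sub>i = (\<Sum>J \<ni> i. \<Prod>j\<in>J. \<sigma>\<^sub>j\<^sup>2) / (\<Sum>J. \<Prod>j\<in>J. \<sigma>\<^sub>j\<^sup>2)\<close> where \<open>J\<close> ranges over the \<open>s\<close>-subsets.
  On the row space of \<open>A\<close>, which contains \<open>x\<^sup>0 - x\<^sub>*\<close>, an injection between index sets shows
  \<open>\<rho> \<le> \<lambda>\<^sub>i \<le> 1\<close>.\<close>

section \<open>Real symmetric matrices\<close>

lemma real_scalar_prod_self:
  fixes v :: "real vec"
  assumes "v \<in> carrier_vec n"
  shows "v \<bullet> v = (\<Sum>i<n. (v $ i)\<^sup>2)"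
  using assms by (auto simp: scalar_prod_def power2_eq_square atLeast0LessThan)

lemma real_scalar_prod_self_nonneg: "(v :: real vec) \<bullet> v \<ge> 0"
  by (simp add: real_scalar_prod_self[OF carrier_vec_dim_vec] sum_nonneg)

lemma real_scalar_prod_self_eq_0_iff:
  fixes v :: "real vec"
  assumes "v \<in> carrier_vec n"
  shows "v \<bullet> v = 0 \<longleftrightarrow> v = 0\<^sub>v n"
  using assms by (auto simp: real_scalar_prod_self sum_nonneg_eq_0_iff)


text \<open>For an eigenvector \<open>v\<close> the Hermitian form \<open>S\<close> equals
  \<open>c\<close> times the squared norm \<open>N\<close>, which is nonzero. Symmetry of
  \<open>A\<close> makes \<open>S\<close> its own conjugate, which forces \<open>c\<close> to be
  real.\<close>

lemma real_symmetric_eigenvalue_real: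
  fixes A :: "real mat"
  assumes A: "A \<in> carrier_mat n n" and sym: "transpose_mat A = A"
    and ev: "eigenvalue (map_mat complex_of_real A) c"
  shows "Im c = 0"
proof -
  let ?A = "map_mat complex_of_real A"
  from ev obtain v where v: "v \<in> carrier_vec n" and v0: "v \<noteq> 0\<^sub>v n"
    and Av: "?A *\<^sub>v v = c \<cdot>\<^sub>v v"
    using A unfolding eigenvalue_def eigenvector_def by auto
  have sym': "A $$ (i,j) = A $$ (j,i)" if "i < n" "j < n" for i j
    using that A sym by (metis carrier_matD index_transpose_mat(1))
  define S where "S = (\<Sum>i<n. \<Sum>j<n. of_real (A $$ (i,j)) * cnj (v $ i) * v $ j)"
  define N where "N = (\<Sum>i<n. (cmod (v $ i))\<^sup>2)"
  have row: "(\<Sum>j<n. of_real (A $$ (i,j)) * v $ j) = c * v $ i" if "i < n" for i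
  proof -
    have "(?A *\<^sub>v v) $ i = (\<Sum>j<n. of_real (A $$ (i,j)) * v $ j)"
      using that A v by (auto simp: scalar_prod_def atLeast0LessThan)
    moreover have "(c \<cdot>\<^sub>v v) $ i = c * v $ i" using that v by auto
    ultimately show ?thesis using Av by simp
  qed
  have "S = (\<Sum>i<n. cnj (v $ i) * (\<Sum>j<n. of_real (A $$ (i,j)) * v $ j))"
    unfolding S_def by (simp add: sum_distrib_left mult_ac)
  also have "\<dots> = (\<Sum>i<n. c * of_real ((cmod (v $ i))\<^sup>2))"
  proof (rule sum.cong[OF refl])
    fix i assume "i \<in> {..<n}"
    hence "cnj (v $ i) * (\<Sum>j<n. of_real (A $$ (i,j)) * v $ j) = cnj (v $ i) * (c * v $ i)"
      by (simp only: row lessThan_iff)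
    thus "cnj (v $ i) * (\<Sum>j<n. of_real (A $$ (i,j)) * v $ j) = c * of_real ((cmod (v $ i))\<^sup>2)"
      by (simp only: complex_norm_square mult_ac)
  qed
  also have "\<dots> = c * of_real N" by (simp add: N_def sum_distrib_left)
  finally have S: "S = c * of_real N" .
  have "cnj S = (\<Sum>i<n. \<Sum>j<n. of_real (A $$ (j,i)) * cnj (v $ j) * v $ i)"
    unfolding S_def by (simp, intro sum.cong refl) (simp add: sym' mult_ac)
  also have "\<dots> = S" unfolding S_def by (rule sum.swap)
  finally have "Im S = 0" by (metis Reals_cnj_iff complex_is_Real_iff)
  hence "Im c * N = 0" unfolding S by simp
  moreover have "N \<noteq> 0"
  proof
    assume "N = 0"
    hence "\<forall>i<n. v $ i = 0" unfolding N_def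
      by (subst (asm) sum_nonneg_eq_0_iff) auto
    thus False using v0 v by auto
  qed
  ultimately show ?thesis by simp
qed

text \<open>The polynomial splits over the complex numbers and all its roots are real. The embedding
  of real polynomials into complex ones is injective, so the factorisation descends.\<close>

lemma real_symmetric_char_poly_splits:
  fixes A :: "real mat"
  assumes A: "A \<in> carrier_mat n n" and sym: "transpose_mat A = A"
  shows "\<exists>es. char_poly A = (\<Prod>e\<leftarrow>es. [:- e, 1:])"
proof -
  let ?A = "map_mat complex_of_real A"
  have cA: "?A \<in> carrier_mat n n" using A by auto
  from char_poly_factorized[OF cA] obtain as
    where as: "char_poly ?A = (\<Prod>a\<leftarrow>as. [:- a, 1:])" by blast
  have real: "Im a = 0" if "a \<in> set as" for a
  proof -
    have "poly (char_poly ?A) a = 0"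
      unfolding as poly_prod_list using that by (auto simp: prod_list_zero_iff image_iff intro!: bexI[of _ a])
    thus ?thesis
      using real_symmetric_eigenvalue_real[OF A sym] eigenvalue_root_char_poly[OF cA] by blast
  qed
  interpret h: map_poly_inj_idom_hom complex_of_real ..
  have "map_poly complex_of_real (char_poly A) = char_poly ?A"
    by (rule of_real_hom.char_poly_hom[OF A, symmetric])
  also have "\<dots> = (\<Prod>a\<leftarrow>as. map_poly complex_of_real [:- Re a, 1:])"
    unfolding as
    by (intro arg_cong[of _ _ prod_list] map_cong refl) (simp add: real complex_eq_iff)
  also have "\<dots> = map_poly complex_of_real (\<Prod>e\<leftarrow>map Re as. [:- e, 1:])"
    by (simp only: h.hom_prod_list map_map o_def)
  finally have "char_poly A = (\<Prod>e\<leftarrow>map Re as. [:- e, 1:])"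
    by (simp only: h.eq_iff)
  thus ?thesis by blast
qed

text \<open>Gram-Schmidt on a basis that starts with \<open>v\<close> keeps \<open>v\<close> as its
  first vector. As \<open>v\<close> has norm one, the final normalisation does not change it
  either.\<close>

lemma orthonormal_completion:
  fixes v :: "real vec"
  assumes v: "v \<in> carrier_vec n" and v1: "v \<bullet> v = 1"
  shows "\<exists>W \<in> carrier_mat n n. transpose_mat W * W = 1\<^sub>m n \<and> col W 0 = v"
proof -
  interpret cof_vec_space n "TYPE(real)" .
  have v0: "v \<noteq> 0\<^sub>v n" using v1 v by auto
  have n0: "n \<noteq> 0" using v1 v by (intro notI) (simp add: scalar_prod_def)
  define b where "b = basis_completion v"
  define ws where "ws = gram_schmidt n b"
  from basis_completion[OF v v0, folded b_def]
  have dist_b: "distinct b" and indep: "\<not> lin_dep (set b)" and b: "set b \<subseteq> carrier_vec n"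
    and hdb: "hd b = v" and len_b: "length b = n" by auto
  from hdb len_b n0 obtain vs where bv: "b = v # vs" by (cases b, auto)
  from gram_schmidt_result[OF b dist_b indep refl, folded ws_def]
  have ws: "set ws \<subseteq> carrier_vec n" "corthogonal ws" "length ws = n"
    by (auto simp: len_b)
  from gram_schmidt_hd[OF v, of vs, folded bv] have hdws: "hd ws = v" unfolding ws_def .
  have ws0: "ws ! 0 = v" using hdws ws(3) n0 by (cases ws, auto)
  have orth: "ws ! i \<bullet> ws ! j = 0 \<longleftrightarrow> i \<noteq> j" if "i < n" "j < n" for i j
    using corthogonalD[OF ws(2), of i j] that ws(3) by auto
  have wsc: "ws ! i \<in> carrier_vec n" if "i < n" for i using ws that by auto
  define c where "c i = 1 / sqrt (ws ! i \<bullet> ws ! i)" for i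
  define W where "W = mat n n (\<lambda>(i,j). c j * ws ! j $ i)"
  have colW: "col W j = c j \<cdot>\<^sub>v ws ! j" if "j < n" for j
    using that wsc[OF that] unfolding W_def by (intro eq_vecI) auto
  have W: "W \<in> carrier_mat n n" unfolding W_def by auto
  have "transpose_mat W * W = 1\<^sub>m n"
  proof (rule eq_matI)
    fix i j assume "i < dim_row (1\<^sub>m n :: real mat)" "j < dim_col (1\<^sub>m n :: real mat)"
    hence ij: "i < n" "j < n" by auto
    have pos: "ws ! i \<bullet> ws ! i > 0"
      using orth[OF ij(1) ij(1)] real_scalar_prod_self_nonneg[of "ws ! i"] by simp
    have "(transpose_mat W * W) $$ (i,j) = col W i \<bullet> col W j" using ij W by auto
    also have "\<dots> = c i * c j * (ws ! i \<bullet> ws ! j)"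
      using ij wsc[OF ij(1)] wsc[OF ij(2)] by (simp add: colW)
    also have "\<dots> = 1\<^sub>m n $$ (i,j)"
    proof (cases "i = j")
      case True
      thus ?thesis using pos ij by (simp add: c_def field_simps)
    qed (use orth[OF ij] ij in auto)
    finally show "(transpose_mat W * W) $$ (i,j) = 1\<^sub>m n $$ (i,j)" .
  qed (use W in auto)
  moreover have "col W 0 = v" using n0 v1 v by (simp add: colW c_def ws0)
  ultimately show ?thesis using W by blast
qed

text \<open>Deflation along the list of eigenvalues: a unit eigenvector for the head is split off
  and the induction hypothesis treats the remaining block. The diagonal keeps the order of the given
  list, so a sorted list gives a sorted diagonal.\<close>

lemma spectral_decomposition:
  fixes A :: "real mat"
  assumes "A \<in> carrier_mat n n" and "transpose_mat A = A"
    and "char_poly A = (\<Prod>e\<leftarrow>es. [:- e, 1:])"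
  shows "length es = n \<and> (\<exists>V \<in> carrier_mat n n. transpose_mat V * V = 1\<^sub>m n \<and>
           transpose_mat V * A * V = mat n n (\<lambda>(i,j). if i = j then es ! i else 0))"
  using assms
proof (induction es arbitrary: n A)
  case Nil
  from degree_monic_char_poly[OF Nil(1)] Nil(3) have n: "n = 0" by auto
  show ?case using Nil(1) unfolding n by (intro conjI bexI[of _ "1\<^sub>m 0"]) (auto intro!: eq_matI)
next
  case (Cons e es n A)
  let ?n1 = "n - 1"
  note A = Cons.prems(1)
  have cp: "char_poly A = [: -e, 1 :] * (\<Prod>e \<leftarrow> es. [:- e, 1:])" using Cons.prems(3) by auto
  have ev: "eigenvalue A e" unfolding eigenvalue_root_char_poly[OF A] cp by simp
  then obtain u where u: "u \<in> carrier_vec n" "u \<noteq> 0\<^sub>v n" and Au: "A *\<^sub>v u = e \<cdot>\<^sub>v u"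
    using A unfolding eigenvalue_def eigenvector_def by auto
  have upos: "u \<bullet> u > 0"
    using u real_scalar_prod_self_nonneg[of u] real_scalar_prod_self_eq_0_iff[OF u(1)] by simp
  define v where "v = (1 / sqrt (u \<bullet> u)) \<cdot>\<^sub>v u"
  have v: "v \<in> carrier_vec n" unfolding v_def using u by auto
  have Av: "A *\<^sub>v v = e \<cdot>\<^sub>v v" unfolding v_def using u A Au
    by (simp add: mult_mat_vec smult_smult_assoc mult.commute)
  have v1: "v \<bullet> v = 1" unfolding v_def using u upos by simp
  have n0: "n \<noteq> 0" using v1 v by (intro notI) (simp add: scalar_prod_def)
  from orthonormal_completion[OF v v1] obtain W where W: "W \<in> carrier_mat n n"
    and WW: "transpose_mat W * W = 1\<^sub>m n" and W0: "col W 0 = v" by auto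
  have Wt: "transpose_mat W \<in> carrier_mat n n" using W by auto
  have WW': "W * transpose_mat W = 1\<^sub>m n" using mat_mult_left_right_inverse[OF Wt W WW] .
  define A' where "A' = transpose_mat W * A * W"
  have A': "A' \<in> carrier_mat n n" unfolding A'_def using W A by auto
  have symA': "transpose_mat A' = A'" unfolding A'_def using W A Cons.prems(2)
    by (simp add: transpose_mult[of _ n n _ n] assoc_mult_mat[of _ n n _ n _ n])
  have sym': "A' $$ (i,j) = A' $$ (j,i)" if "i < n" "j < n" for i j
    using that A' symA' by (metis carrier_matD index_transpose_mat(1))
  have sim: "similar_mat A' A"
    unfolding similar_mat_def
    by (intro exI[of _ "transpose_mat W"] exI[of _ W] similar_mat_witI[OF WW WW'])
      (use W A A' in \<open>auto simp: A'_def\<close>)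
  have col0: "col A' 0 = e \<cdot>\<^sub>v unit_vec n 0"
  proof -
    have WtA: "transpose_mat W * A \<in> carrier_mat n n" using Wt A by simp
    have "col A' 0 = (transpose_mat W * A) *\<^sub>v col W 0"
      unfolding A'_def using n0 by (intro col_mult2[OF WtA W]) simp
    also have "\<dots> = transpose_mat W *\<^sub>v (A *\<^sub>v col W 0)"
      unfolding W0 by (rule assoc_mult_mat_vec[OF Wt A v])
    also have "\<dots> = e \<cdot>\<^sub>v (transpose_mat W *\<^sub>v col W 0)"
      unfolding W0 Av using v Wt by (simp add: mult_mat_vec)
    also have "transpose_mat W *\<^sub>v col W 0 = col (transpose_mat W * W) 0"
      using n0 by (intro col_mult2[OF Wt W, symmetric]) simp
    also have "\<dots> = unit_vec n 0" unfolding WW using n0 by simp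
    finally show ?thesis .
  qed
  have A'0: "A' $$ (i,0) = (if i = 0 then e else 0)" if "i < n" for i
    using arg_cong[OF col0, of "\<lambda>w. w $ i"] that A' n0 by (auto simp: unit_vec_def)
  have A'0': "A' $$ (0,i) = (if i = 0 then e else 0)" if "i < n" for i
    using A'0[OF that] sym'[of 0 i] n0 that by simp
  define A3 where "A3 = mat ?n1 ?n1 (\<lambda>(i,j). A' $$ (Suc i, Suc j))"
  have A3: "A3 \<in> carrier_mat ?n1 ?n1" unfolding A3_def by auto
  let ?E = "mat 1 1 (\<lambda>_. e)"
  \<comment> \<open>The first column of \<open>W\<close> is an eigenvector, which clears the first
    column of \<open>A'\<close> below the corner; symmetry then clears the first row.\<close>
  have A'block: "A' = four_block_mat ?E (0\<^sub>m 1 ?n1) (0\<^sub>m ?n1 1) A3"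
    by (rule eq_matI) (use A' n0 in \<open>auto simp: A'0 A'0' A3_def\<close>)
  have symA3: "transpose_mat A3 = A3"
    unfolding A3_def
    by (intro eq_matI) (auto simp: sym')
  have "[: -e,1 :] * (\<Prod> e \<leftarrow> es. [:- e, 1:]) = char_poly A'"
    using cp char_poly_similar[OF sim] by simp
  also have "\<dots> = char_poly ?E * char_poly A3"
    unfolding A'block by (rule char_poly_four_block_zeros_col[OF _ _ A3]) auto
  also have "char_poly ?E = [: -e,1 :]"
    by (simp add: char_poly_defs det_def sign_def)
  finally have cp3: "char_poly A3 = (\<Prod> e \<leftarrow> es. [:- e, 1:])"
    by (metis mult_cancel_left pCons_eq_0_iff zero_neq_one)
  from Cons.IH[OF A3 symA3 cp3] obtain U where len: "length es = ?n1"
    and U: "U \<in> carrier_mat ?n1 ?n1" and UU: "transpose_mat U * U = 1\<^sub>m ?n1"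
    and UA: "transpose_mat U * A3 * U = mat ?n1 ?n1 (\<lambda>(i,j). if i = j then es ! i else 0)"
    by auto
  \<comment> \<open>\<open>F\<close> fixes the split-off direction and diagonalises the remaining
    block, so \<open>W * F\<close> diagonalises \<open>A\<close>.\<close>
  define F where "F = four_block_mat (1\<^sub>m 1) (0\<^sub>m 1 ?n1) (0\<^sub>m ?n1 1) U"
  have F: "F \<in> carrier_mat n n"
    using four_block_carrier_mat[OF one_carrier_mat[of 1] U] n0 unfolding F_def by simp
  have Ft: "transpose_mat F = four_block_mat (1\<^sub>m 1) (0\<^sub>m 1 ?n1) (0\<^sub>m ?n1 1) (transpose_mat U)"
    unfolding F_def using U by (subst transpose_four_block_mat[of _ 1 1 _ ?n1 _ ?n1]) auto
  have FF: "transpose_mat F * F = 1\<^sub>m n"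
    unfolding Ft unfolding F_def using U
    by (subst mult_four_block_mat[of _ 1 1 _ ?n1 _ ?n1 _ _ 1 _ ?n1]) (use n0 UU in \<open>auto intro!: eq_matI\<close>)
  have FA: "transpose_mat F * A' * F = mat n n (\<lambda>(i,j). if i = j then (e # es) ! i else 0)"
  proof -
    have "transpose_mat F * A' = four_block_mat ?E (0\<^sub>m 1 ?n1) (0\<^sub>m ?n1 1) (transpose_mat U * A3)"
      unfolding Ft A'block using U A3
      by (subst mult_four_block_mat[of _ 1 1 _ ?n1 _ ?n1 _ _ 1 _ ?n1]) auto
    also have "\<dots> * F = four_block_mat ?E (0\<^sub>m 1 ?n1) (0\<^sub>m ?n1 1) (transpose_mat U * A3 * U)"
      unfolding F_def using U A3
      by (subst mult_four_block_mat[of _ 1 1 _ ?n1 _ ?n1 _ _ 1 _ ?n1]) auto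
    finally show ?thesis unfolding UA using n0
      by (intro eq_matI) (auto simp: nth_Cons split: nat.splits)
  qed
  have "transpose_mat (W * F) * (W * F) = transpose_mat F * ((transpose_mat W * W) * F)"
    using W F by (simp add: transpose_mult[of _ n n _ n] assoc_mult_mat[of _ n n _ n _ n])
  hence 1: "transpose_mat (W * F) * (W * F) = 1\<^sub>m n" unfolding WW using F FF by simp
  have 2: "transpose_mat (W * F) * A * (W * F) = transpose_mat F * A' * F"
    unfolding A'_def using W F A
    by (simp add: transpose_mult[of _ n n _ n] assoc_mult_mat[of _ n n _ n _ n])
  show ?case using len n0 W F 1 2 FA by (intro conjI bexI[of _ "W * F"]) auto
qed

section \<open>Rank and singular values\<close>

text \<open>An invertible factor on the right only reparametrises the arguments, so both matrices
  have the same column space.\<close>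

lemma rank_mult_orthogonal:
  fixes A V :: "real mat"
  assumes A: "A \<in> carrier_mat m n" and V: "V \<in> carrier_mat n n" and VV: "V * transpose_mat V = 1\<^sub>m n"
  shows "vec_space.rank m (A * V) = vec_space.rank m A"
proof -
  interpret vec_space "TYPE(real)" m .
  have Vt: "transpose_mat V \<in> carrier_mat n n" using V by auto
  have "\<exists>z\<in>carrier_vec n. (A * V) *\<^sub>v z = A *\<^sub>v x" if x: "x \<in> carrier_vec n" for x
  proof (rule bexI[of _ "transpose_mat V *\<^sub>v x"])
    have "(A * V) *\<^sub>v (transpose_mat V *\<^sub>v x) = A *\<^sub>v ((V * transpose_mat V) *\<^sub>v x)"
      using A V Vt x by (simp add: assoc_mult_mat_vec[of _ m n _ n] assoc_mult_mat_vec[of _ n n _ n])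
    thus "(A * V) *\<^sub>v (transpose_mat V *\<^sub>v x) = A *\<^sub>v x" using x VV by simp
  qed (use Vt x in auto)
  moreover have "\<exists>z\<in>carrier_vec n. A *\<^sub>v z = (A * V) *\<^sub>v x" if x: "x \<in> carrier_vec n" for x
    using A V x by (intro bexI[of _ "V *\<^sub>v x"]) (auto simp: assoc_mult_mat_vec[of _ m n _ n])
  moreover have "col_space B = (\<lambda>x. B *\<^sub>v x) ` carrier_vec n" if "B \<in> carrier_mat m n" for B
    using that by (auto simp: col_space_eq[OF that])
  ultimately have "col_space (A * V) = col_space A" using A V by (auto simp: image_iff) metis+
  thus ?thesis unfolding rank_def col_space_def by simp
qed

text \<open>\<open>d i\<close> is the squared norm of column \<open>i\<close>. The nonzero columns
  are independent by orthogonality, and they form a maximal independent set because every other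
  column is zero.\<close>

lemma rank_orthogonal_cols:
  fixes W :: "real mat"
  assumes W: "W \<in> carrier_mat m n"
    and orth: "\<And>i j. i < n \<Longrightarrow> j < n \<Longrightarrow> col W i \<bullet> col W j = (if i = j then d i else 0)"
  shows "vec_space.rank m W = card {i. i < n \<and> d i \<noteq> 0}"
proof -
  interpret vec_space "TYPE(real)" m .
  let ?I = "{i. i < n \<and> d i \<noteq> 0}"
  let ?S = "col W ` ?I"
  have colc: "col W i \<in> carrier_vec m" if "i < n" for i using W by auto
  have S: "?S \<subseteq> carrier_vec m" using colc by auto
  have inj: "inj_on (col W) ?I"
  proof (rule inj_onI)
    fix i j assume "i \<in> ?I" "j \<in> ?I" "col W i = col W j"
    thus "i = j" using orth[of i j] orth[of i i] by (cases "i = j") auto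
  qed
  have zero: "col W i = 0\<^sub>v m" if "i < n" "d i = 0" for i
    using orth[of i i] that real_scalar_prod_self_eq_0_iff[OF colc] by auto
  have indpt: "lin_indpt ?S"
  proof (rule finite_lin_indpt2)
    fix a assume lc: "lincomb a ?S = 0\<^sub>v m"
    show "\<forall>v\<in>?S. a v = 0"
    proof
      fix v assume "v \<in> ?S"
      then obtain j where j: "j < n" "d j \<noteq> 0" and v: "v = col W j" by auto
      \<comment> \<open>Pairing the vanishing combination with column \<open>j\<close> isolates the
        coefficient of that column.\<close>
      have "0 = (\<Sum>k<m. col W j $ k * lincomb a ?S $ k)" unfolding lc by simp
      also have "\<dots> = (\<Sum>k<m. col W j $ k * (\<Sum>x\<in>?S. a x * x $ k))"
        using S by (intro sum.cong refl) (simp add: lincomb_index)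
      also have "\<dots> = (\<Sum>x\<in>?S. a x * (\<Sum>k<m. col W j $ k * x $ k))"
        by (simp only: sum_distrib_left, subst sum.swap) (simp add: mult_ac)
      also have "\<dots> = (\<Sum>x\<in>?S. a x * (col W j \<bullet> x))"
        using S by (intro sum.cong refl) (auto simp: scalar_prod_def atLeast0LessThan W[THEN carrier_matD(1)])
      also have "\<dots> = (\<Sum>i\<in>?I. a (col W i) * (col W j \<bullet> col W i))"
        by (subst sum.reindex[OF inj]) simp
      also have "\<dots> = (\<Sum>i\<in>?I. if i = j then a (col W j) * d j else 0)"
        using j by (intro sum.cong refl) (auto simp: orth)
      also have "\<dots> = a v * d j" using j v by simp
      finally show "a v = 0" using j by simp
    qed
  qed (use S in auto)
  have cols: "set (cols W) = col W ` {0..<n}" using W by (auto simp: cols_def)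
  have colsc: "set (cols W) \<subseteq> carrier_vec m" unfolding cols using colc by auto
  have "maximal ?S (\<lambda>T. T \<subseteq> set (cols W) \<and> lin_indpt T)"
    unfolding maximal_def
  proof (intro conjI allI impI)
    show "?S \<subseteq> set (cols W)" unfolding cols by auto
    show "lin_indpt ?S" by (rule indpt)
    fix T assume T: "?S \<subseteq> T \<and> T \<subseteq> set (cols W) \<and> lin_indpt T"
    hence Tc: "T \<subseteq> carrier_vec m" using colsc by blast
    have z: "0\<^sub>v m \<notin> T" using vs_zero_lin_dep[of T] T Tc by auto
    have "T \<subseteq> ?S"
    proof
      fix x assume x: "x \<in> T"
      then obtain i where i: "i < n" "x = col W i" using T cols by auto
      moreover have "d i \<noteq> 0" using i x z zero by metis
      ultimately show "x \<in> ?S" by simp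
    qed
    thus "T = ?S" using T by blast
  qed
  from rank_card_indpt[OF W this] show ?thesis using inj by (simp add: card_image)
qed

text \<open>\<open>V\<close> orthogonally diagonalises the Gram matrix of \<open>A\<close>, so the
  eigenvalues are the squared norms of the columns of \<open>A * V\<close>. The rank counts the
  nonzero ones, and by the descending order these occupy an initial segment of the indices.\<close>

lemma ex_right_singular_basis:
  fixes A :: "real mat"
  assumes A: "A \<in> carrier_mat m n"
  obtains V where "V \<in> carrier_mat n n" and "transpose_mat V * V = 1\<^sub>m n"
    and "\<And>i j. i < n \<Longrightarrow> j < n \<Longrightarrow>
      col (A * V) i \<bullet> col (A * V) j = (if i = j then sing_sq A i else 0)"
    and "\<And>i j. i \<le> j \<Longrightarrow> j < n \<Longrightarrow> sing_sq A j \<le> sing_sq A i"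
    and "\<And>i. i < n \<Longrightarrow> sing_sq A i \<ge> 0"
    and "\<And>i. i < n \<Longrightarrow> sing_sq A i > 0 \<longleftrightarrow> i < mat_rank A"
    and "mat_rank A \<le> n"
proof -
  let ?G = "transpose_mat A * A"
  have G: "?G \<in> carrier_mat n n" using A by auto
  have sym: "transpose_mat ?G = ?G" using A by (simp add: transpose_mult[of _ n m])
  define es where "es = rev (sorted_list_of_multiset (proots (char_poly ?G)))"
  obtain fs where fs: "char_poly ?G = (\<Prod>e\<leftarrow>fs. [:- e, 1:])"
    using real_symmetric_char_poly_splits[OF G sym] by blast
  \<comment> \<open>The root list \<open>fs\<close> is a permutation of the sorted list
    \<open>es\<close> behind \<open>sing_sq\<close>, so the splitting can be rewritten in descending
    order.\<close>
  have "proots (char_poly ?G) = mset fs"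
    unfolding fs
  proof (induction fs)
    case (Cons a fs)
    have "(\<Prod>e\<leftarrow>fs. [:- e, 1:]) \<noteq> 0" by (auto simp: prod_list_zero_iff)
    thus ?case using Cons by (simp add: proots_mult del: mult_pCons_left)
  qed simp
  hence ms: "mset es = mset fs" unfolding es_def by simp
  have "char_poly ?G = prod_mset (image_mset (\<lambda>e. [:- e, 1:]) (mset fs))"
    by (simp only: fs mset_map[symmetric] prod_mset_prod_list)
  also have "\<dots> = (\<Prod>e\<leftarrow>es. [:- e, 1:])"
    by (simp only: ms[symmetric] mset_map[symmetric] prod_mset_prod_list)
  finally have split: "char_poly ?G = (\<Prod>e\<leftarrow>es. [:- e, 1:])" .
  from spectral_decomposition[OF G sym split] obtain V where len: "length es = n"
    and V: "V \<in> carrier_mat n n" and VV: "transpose_mat V * V = 1\<^sub>m n"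
    and diag: "transpose_mat V * ?G * V = mat n n (\<lambda>(i,j). if i = j then es ! i else 0)" by blast
  have sing: "sing_sq A i = es ! i" for i by (simp add: sing_sq_def es_def)
  have AV: "A * V \<in> carrier_mat m n" using A V by auto
  have orth: "col (A * V) i \<bullet> col (A * V) j = (if i = j then sing_sq A i else 0)"
    if "i < n" "j < n" for i j
  proof -
    have "col (A * V) i \<bullet> col (A * V) j = (transpose_mat (A * V) * (A * V)) $$ (i,j)"
      using AV A V that by (simp add: row_transpose)
    also have "transpose_mat (A * V) * (A * V) = transpose_mat V * ?G * V"
      using A V by (simp add: transpose_mult[of _ m n _ n] assoc_mult_mat[of _ n m _ n _ n]
         assoc_mult_mat[of _ n n _ m _ n] assoc_mult_mat[of _ n n _ n _ n])
    finally show ?thesis unfolding diag sing using that by simp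
  qed
  have desc: "sing_sq A j \<le> sing_sq A i" if "i \<le> j" "j < n" for i j
    unfolding sing
    by (rule sorted_rev_nth_mono) (use that len in \<open>auto simp: es_def sorted_sorted_list_of_multiset\<close>)
  have nonneg: "sing_sq A i \<ge> 0" if "i < n" for i
    using orth[OF that that] real_scalar_prod_self_nonneg[of "col (A * V) i"] by simp
  have VV': "V * transpose_mat V = 1\<^sub>m n"
    using mat_mult_left_right_inverse[OF _ V VV] V by auto
  let ?I = "{i. i < n \<and> sing_sq A i \<noteq> 0}"
  have rank: "mat_rank A = card ?I"
    using rank_mult_orthogonal[OF A V VV'] rank_orthogonal_cols[OF AV orth] A by (simp add: mat_rank_def)
  have fin: "finite ?I" by simp
  have pos: "sing_sq A i > 0 \<longleftrightarrow> i < mat_rank A" if i: "i < n" for i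
  proof
    assume p: "sing_sq A i > 0"
    have "{0..i} \<subseteq> ?I" using desc[OF _ i] p i by fastforce
    from card_mono[OF fin this] show "i < mat_rank A" unfolding rank by simp
  next
    assume r: "i < mat_rank A"
    show "sing_sq A i > 0"
    proof (rule ccontr)
      assume "\<not> sing_sq A i > 0"
      hence z: "sing_sq A i \<le> 0" by simp
      have "?I \<subseteq> {0..<i}"
      proof
        fix j assume j: "j \<in> ?I"
        show "j \<in> {0..<i}" using j desc[of i j] nonneg[of j] z by (cases "i \<le> j") auto
      qed
      from card_mono[OF _ this] show False using r unfolding rank by simp
    qed
  qed
  have "?I \<subseteq> {0..<n}" by auto
  from card_mono[OF _ this] have "mat_rank A \<le> n" unfolding rank by simp
  with that V VV orth desc nonneg pos show thesis by blast
qed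

section \<open>Pseudoinverses\<close>

text \<open>Transposing \<open>A * X = (A * Y) * (A * X)\<close> swaps the symmetric factors and
  yields \<open>A * X = A * Y\<close>; likewise \<open>X * A = Y * A\<close>. Then
  \<open>X = X * A * X\<close> turns into \<open>Y * A * Y = Y\<close>.\<close>

lemma is_pinv_unique:
  assumes X: "is_pinv A X" and Y: "is_pinv A Y"
  shows "X = Y"
proof -
  define m n where "m = dim_row A" and "n = dim_col A"
  have A: "A \<in> carrier_mat m n" unfolding m_def n_def by simp
  from X have Xc: "X \<in> carrier_mat n m" and X1: "A * X * A = A" and X2: "X * A * X = X"
    and X3: "transpose_mat (A * X) = A * X" and X4: "transpose_mat (X * A) = X * A"
    unfolding is_pinv_def m_def n_def by auto
  from Y have Yc: "Y \<in> carrier_mat n m" and Y1: "A * Y * A = A" and Y2: "Y * A * Y = Y"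
    and Y3: "transpose_mat (A * Y) = A * Y" and Y4: "transpose_mat (Y * A) = Y * A"
    unfolding is_pinv_def m_def n_def by auto
  have "A * X = A * Y * A * X" by (simp add: Y1)
  also have "\<dots> = (A * Y) * (A * X)" using A Xc Yc by (intro assoc_mult_mat[of _ m m _ n _ m]) auto
  finally have "transpose_mat (A * X) = transpose_mat ((A * Y) * (A * X))" by simp
  also have "\<dots> = (A * X) * (A * Y)"
    using A Xc Yc by (subst transpose_mult[of _ m m _ m]) (auto simp: X3 Y3)
  also have "\<dots> = (A * X * A) * Y" using A Xc Yc by (intro assoc_mult_mat[of _ m m _ n _ m, symmetric]) auto
  finally have AXY: "A * X = A * Y" by (simp add: X1 X3)
  have "X * A = X * (A * Y * A)" by (simp add: Y1)
  also have "\<dots> = (X * A) * (Y * A)" using A Xc Yc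
    by (simp add: assoc_mult_mat[of _ n m _ n _ n] assoc_mult_mat[of _ m n _ m _ n])
  finally have "transpose_mat (X * A) = transpose_mat ((X * A) * (Y * A))" by simp
  also have "\<dots> = (Y * A) * (X * A)"
    using A Xc Yc by (subst transpose_mult[of _ n n _ n]) (auto simp: X4 Y4)
  also have "\<dots> = Y * (A * X * A)" using A Xc Yc
    by (simp add: assoc_mult_mat[of _ n m _ n _ n] assoc_mult_mat[of _ m n _ m _ n])
  finally have XYA: "X * A = Y * A" by (simp add: X1 X4)
  have "X = X * A * X" by (simp add: X2)
  also have "\<dots> = Y * (A * X)" unfolding XYA using A Xc Yc by (intro assoc_mult_mat) auto
  also have "\<dots> = Y * A * Y" unfolding AXY using A Yc by (intro assoc_mult_mat[symmetric]) auto
  finally show ?thesis by (simp add: Y2)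
qed

text \<open>With \<open>W = A * V\<close>, whose Gram matrix \<open>D\<close> is diagonal, the
  witness is \<open>V\<close>, times the pseudoinverse of \<open>D\<close>, times the transpose of
  \<open>W\<close>.\<close>

lemma ex_is_pinv:
  fixes A :: "real mat"
  shows "\<exists>X. is_pinv A X"
proof -
  define m n where "m = dim_row A" and "n = dim_col A"
  have A: "A \<in> carrier_mat m n" unfolding m_def n_def by simp
  obtain V where V: "V \<in> carrier_mat n n"
    and VV: "transpose_mat V * V = 1\<^sub>m n"
    and orth: "\<And>i j. i < n \<Longrightarrow> j < n \<Longrightarrow>
      col (A * V) i \<bullet> col (A * V) j = (if i = j then sing_sq A i else 0)"
    by (rule ex_right_singular_basis[OF A], rule that)
  have Vt: "transpose_mat V \<in> carrier_mat n n" using V by simp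
  have VV': "V * transpose_mat V = 1\<^sub>m n" using mat_mult_left_right_inverse[OF Vt V VV] .
  define W where "W = A * V"
  define D where "D = mat n n (\<lambda>(i,j). if i = j then sing_sq A i else 0)"
  \<comment> \<open>Division by zero yields zero, so \<open>P\<close> is the pseudoinverse of
    \<open>D\<close> also at vanishing singular values.\<close>
  define P where "P = mat n n (\<lambda>(i,j). if i = j then 1 / sing_sq A i else 0)"
  have W: "W \<in> carrier_mat m n" and Wt: "transpose_mat W \<in> carrier_mat n m"
    and D: "D \<in> carrier_mat n n" and P: "P \<in> carrier_mat n n"
    using A V unfolding W_def D_def P_def by auto
  have WW: "transpose_mat W * W = D"
    by (rule eq_matI) (use W orth in \<open>auto simp: D_def W_def[symmetric]\<close>)
  have AW: "A = W * transpose_mat V"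
    unfolding W_def using A V Vt by (simp add: assoc_mult_mat[of _ m n _ n _ n] VV')
  have zero: "W $$ (k,j) = 0" if "k < m" "j < n" "sing_sq A j = 0" for k j
  proof -
    have "col W j \<in> carrier_vec m" using W by auto
    from real_scalar_prod_self_eq_0_iff[OF this] have "col W j = 0\<^sub>v m"
      using orth[OF that(2,2)] that(3) by (simp add: W_def)
    hence "col W j $ k = 0" using that by simp
    thus ?thesis using that W by simp
  qed
  have PD: "P * D = mat n n (\<lambda>(i,j). if i = j \<and> sing_sq A i \<noteq> 0 then 1 else 0)"
    by (rule eq_matI) (auto simp: P_def D_def scalar_prod_def if_distrib[of "\<lambda>x. _ * x"] cong: if_cong)
  have PDc: "P * D \<in> carrier_mat n n" using P D by auto
  have PDt: "transpose_mat (P * D) = P * D" unfolding PD by (rule eq_matI) auto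
  have Pt: "transpose_mat P = P" unfolding P_def by (rule eq_matI) auto
  have PDP: "P * D * P = P"
    unfolding PD by (rule eq_matI) (auto simp: P_def scalar_prod_def if_distrib[of "\<lambda>x. _ * x"] cong: if_cong)
  \<comment> \<open>\<open>P * D\<close> is the indicator of the nonzero singular values; it only
    erases columns of \<open>W\<close> that are zero anyway.\<close>
  have WPD: "W * (P * D) = W"
  proof (rule eq_matI)
    fix k j assume "k < dim_row W" "j < dim_col W"
    hence kj: "k < m" "j < n" using W by auto
    have "(W * (P * D)) $$ (k,j)
        = (\<Sum>i<n. W $$ (k,i) * (if i = j \<and> sing_sq A i \<noteq> 0 then 1 else 0))"
      unfolding PD using W kj by (simp add: scalar_prod_def atLeast0LessThan)
    also have "\<dots> = (\<Sum>i<n. if i = j then W $$ (k,i) else 0)"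
      using zero kj by (intro sum.cong refl) auto
    finally show "(W * (P * D)) $$ (k,j) = W $$ (k,j)" using kj by simp
  qed (use W PDc in auto)
  define X where "X = V * P * transpose_mat W"
  have X: "X \<in> carrier_mat n m" using V P Wt unfolding X_def by auto
  have AX: "A * X = W * P * transpose_mat W"
  proof -
    have "A * X = W * ((transpose_mat V * V) * P * transpose_mat W)"
      unfolding AW X_def using V Vt P W Wt
      by (simp add: assoc_mult_mat[of _ m n _ n _ m] assoc_mult_mat[of _ n n _ n _ m]
        assoc_mult_mat[of _ n n _ n _ n])
    thus ?thesis unfolding VV using P W Wt by (simp add: assoc_mult_mat[of _ m n _ n _ m])
  qed
  have XA: "X * A = V * (P * D) * transpose_mat V"
  proof -
    have "X * A = V * (P * (transpose_mat W * W)) * transpose_mat V"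
      unfolding AW X_def using V Vt P W Wt
      by (simp add: assoc_mult_mat[of _ n m _ n _ n] assoc_mult_mat[of _ n n _ n _ n]
        assoc_mult_mat[of _ n n _ m _ n])
    thus ?thesis unfolding WW .
  qed
  have 1: "A * X * A = A"
  proof -
    have "A * X * A = W * (P * (transpose_mat W * W)) * transpose_mat V"
      unfolding AX unfolding AW using V Vt P W Wt
      by (simp add: assoc_mult_mat[of _ m n _ n _ n] assoc_mult_mat[of _ m n _ m _ n] assoc_mult_mat[of _ m m _ n _ n]
        assoc_mult_mat[of _ n m _ n _ n] assoc_mult_mat[of _ n n _ m _ n] assoc_mult_mat[of _ n n _ n _ n])
    thus ?thesis unfolding WW WPD using AW by simp
  qed
  have 2: "X * A * X = X"
  proof -
    have "X * A * X = V * (P * D * ((transpose_mat V * V) * P)) * transpose_mat W"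
      unfolding XA unfolding X_def using V Vt P PDc Wt
      by (simp add: assoc_mult_mat[of _ n n _ n _ m] assoc_mult_mat[of _ n n _ n _ n])
    thus ?thesis unfolding VV X_def using P PDP by simp
  qed
  have 3: "transpose_mat (A * X) = A * X"
    unfolding AX using W P Wt
    by (simp add: transpose_mult[of _ m n _ m] transpose_mult[of _ m n _ n] transpose_mult[of _ n n _ m] Pt assoc_mult_mat[of _ m n _ n _ m])
  have 4: "transpose_mat (X * A) = X * A"
    unfolding XA using V PDc Vt
    by (simp add: transpose_mult[of _ n n _ n] PDt assoc_mult_mat[of _ n n _ n _ n])
  show ?thesis using 1 2 3 4 X unfolding is_pinv_def m_def n_def by blast
qed

lemma is_pinv_pinv: "is_pinv A (pinv A)"
  unfolding pinv_def using ex_is_pinv is_pinv_unique by (metis theI')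

section \<open>Sums of principal minors\<close>

lemma finite_subsets_s: "finite (subsets_s n s)"
  unfolding subsets_s_def by (rule finite_subset[of _ "Pow {0..<n}"]) auto

text \<open>The bordered matrix with diagonal blocks 1, upper right block \<open>u\<close> and lower
  left block \<open>-v\<close> factors as \<open>?L * ?X\<close> and as \<open>?Y * ?L\<close>. All
  three factors are block triangular, and comparing determinants gives the formula.\<close>

lemma det_one_plus_rank_one:
  fixes u v :: "'a :: idom vec"
  assumes u: "u \<in> carrier_vec n" and v: "v \<in> carrier_vec n"
  shows "det (mat n n (\<lambda>(i,j). (if i = j then 1 else 0) + u $ i * v $ j)) = 1 + v \<bullet> u"
proof -
  define U where "U = mat n 1 (\<lambda>(i,j). u $ i)"
  define R where "R = mat 1 n (\<lambda>(i,j). - v $ j)"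
  define M where "M = mat n n (\<lambda>(i,j). (if i = j then 1 else 0) + u $ i * v $ j)"
  define q where "q = mat 1 1 (\<lambda>_. 1 + v \<bullet> u)"
  have U: "U \<in> carrier_mat n 1" and R: "R \<in> carrier_mat 1 n" and M: "M \<in> carrier_mat n n"
    and q: "q \<in> carrier_mat 1 1"
    by (auto simp: U_def R_def M_def q_def)
  let ?L = "four_block_mat (1\<^sub>m n) (0\<^sub>m n 1) R (1\<^sub>m 1)"
  let ?X = "four_block_mat (1\<^sub>m n) U (0\<^sub>m 1 n) q"
  let ?Y = "four_block_mat M U (0\<^sub>m 1 n) (1\<^sub>m 1)"
  have RU: "R * U + q = 1\<^sub>m 1"
    using u v by (intro eq_matI) (auto simp: R_def U_def q_def scalar_prod_def sum_negf)
  have MUR: "M + U * R = 1\<^sub>m n"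
    by (intro eq_matI) (auto simp: R_def U_def M_def scalar_prod_def)
  have "?L * ?X = four_block_mat (1\<^sub>m n) U R (1\<^sub>m 1)"
    using U R q RU by (subst mult_four_block_mat[of _ n n _ 1 _ 1 _ _ n _ 1]) auto
  also have "\<dots> = ?Y * ?L"
    using U R M MUR by (subst mult_four_block_mat[of _ n n _ 1 _ 1 _ _ n _ 1]) auto
  finally have "det (?L * ?X) = det (?Y * ?L)" by simp
  moreover have cL: "?L \<in> carrier_mat (n + 1) (n + 1)" "?X \<in> carrier_mat (n + 1) (n + 1)"
    "?Y \<in> carrier_mat (n + 1) (n + 1)" using U R M q by (auto intro!: four_block_carrier_mat)
  moreover have "det ?L = 1"
    using R by (subst det_four_block_mat_upper_right_zero[of _ n _ 1]) auto
  moreover have "det ?X = det q"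
    using U q by (subst det_four_block_mat_lower_left_zero[of _ n _ 1]) auto
  moreover have "det ?Y = det M"
    using U M by (subst det_four_block_mat_lower_left_zero[of _ n _ 1]) auto
  moreover have "det q = 1 + v \<bullet> u" by (simp add: q_def det_single)
  ultimately show ?thesis by (simp add: det_mult[of _ "n + 1"] M_def[symmetric])
qed

text \<open>The values outside \<open>{0..<s}\<close> are normalised to the identity, as in the library's
  row expansion of determinants.\<close>

definition tuples :: "nat \<Rightarrow> nat \<Rightarrow> (nat \<Rightarrow> nat) set" where
  "tuples s n = {f. (\<forall>i\<in>{0..<s}. f i \<in> {0..<n}) \<and> (\<forall>i. i \<notin> {0..<s} \<longrightarrow> f i = i)}"

lemma finite_tuples: "finite (tuples s n)"
  unfolding tuples_def by (rule finite_bounded_functions) auto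

text \<open>Multilinearity in the rows, the first half of the Cauchy-Binet argument. Tuples with
  repetitions are kept here.\<close>

lemma det_rows_expansion:
  fixes a b :: "nat \<Rightarrow> nat \<Rightarrow> 'a :: comm_ring_1"
  shows "det (mat s s (\<lambda>(i,j). \<Sum>k<n. a i k * b k j)) =
    (\<Sum>g\<in>tuples s n. (\<Prod>i<s. a i (g i)) * det (mat s s (\<lambda>(i,j). b (g i) j)))"
proof -
  let ?v = "\<lambda>i k. a i k \<cdot>\<^sub>v vec s (b k)"
  have "mat s s (\<lambda>(i,j). \<Sum>k<n. a i k * b k j)
      = mat\<^sub>r s s (\<lambda>i. finsum_vec TYPE('a) s (?v i) {0..<n})"
    by (rule eq_matI) (auto simp: index_finsum_vec atLeast0LessThan)
  also have "det \<dots> = (\<Sum>g\<in>tuples s n. det (mat\<^sub>r s s (\<lambda>i. ?v i (g i))))"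
    unfolding tuples_def by (rule det_linear_rows_sum) auto
  also have "\<dots> = (\<Sum>g\<in>tuples s n. (\<Prod>i<s. a i (g i)) * det (mat s s (\<lambda>(i,j). b (g i) j)))"
  proof (rule sum.cong[OF refl])
    fix g
    have "det (mat\<^sub>r s s (\<lambda>i. ?v i (g i)))
        = prod (\<lambda>i. a i (g i)) {0..<s} * det (mat\<^sub>r s s (\<lambda>i. vec s (b (g i))))"
      by (rule det_rows_mul) auto
    also have "mat\<^sub>r s s (\<lambda>i. vec s (b (g i))) = mat s s (\<lambda>(i,j). b (g i) j)"
      by (rule eq_matI) auto
    finally show "det (mat\<^sub>r s s (\<lambda>i. ?v i (g i)))
        = (\<Prod>i<s. a i (g i)) * det (mat s s (\<lambda>(i,j). b (g i) j))"
      by (simp add: atLeast0LessThan)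
  qed
  finally show ?thesis .
qed

lemma det_mat_transpose:
  fixes F :: "nat \<Rightarrow> nat \<Rightarrow> 'a :: comm_ring_1"
  shows "det (mat s s (\<lambda>(i,j). F j i)) = det (mat s s (\<lambda>(i,j). F i j))"
proof -
  have "mat s s (\<lambda>(i,j). F j i) = transpose_mat (mat s s (\<lambda>(i,j). F i j))"
    by (rule eq_matI) auto
  thus ?thesis by (simp add: det_transpose[of _ s])
qed

text \<open>Both sides expand to the same double sum over \<open>f\<close> and \<open>g\<close>, up
  to the order of summation and a transposition inside the determinants.\<close>

lemma sum_det_tuples_commute:
  fixes X Y :: "nat \<Rightarrow> nat \<Rightarrow> 'a :: comm_ring_1"
  shows "(\<Sum>f\<in>tuples s m. det (mat s s (\<lambda>(i,j). \<Sum>k<n. X (f i) k * Y k (f j)))) =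
         (\<Sum>g\<in>tuples s n. det (mat s s (\<lambda>(i,j). \<Sum>k<m. Y (g i) k * X k (g j))))"
proof -
  have "(\<Sum>f\<in>tuples s m. det (mat s s (\<lambda>(i,j). \<Sum>k<n. X (f i) k * Y k (f j)))) =
    (\<Sum>f\<in>tuples s m. \<Sum>g\<in>tuples s n. (\<Prod>i<s. X (f i) (g i)) * det (mat s s (\<lambda>(i,j). Y (g i) (f j))))"
    by (rule sum.cong[OF refl]) (rule det_rows_expansion)
  also have "\<dots> = (\<Sum>g\<in>tuples s n. \<Sum>f\<in>tuples s m. (\<Prod>i<s. X (f i) (g i)) * det (mat s s (\<lambda>(i,j). Y (g i) (f j))))"
    by (rule sum.swap)
  also have "\<dots> = (\<Sum>g\<in>tuples s n. det (mat s s (\<lambda>(i,j). \<Sum>k<m. Y (g i) k * X k (g j))))"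
  proof (rule sum.cong[OF refl])
    fix g
    have "det (mat s s (\<lambda>(i,j). \<Sum>k<m. Y (g i) k * X k (g j)))
        = det (mat s s (\<lambda>(i,j). \<Sum>k<m. X k (g i) * Y (g j) k))"
      by (subst det_mat_transpose[symmetric]) (simp add: mult.commute)
    also have "\<dots> = (\<Sum>f\<in>tuples s m. (\<Prod>i<s. X (f i) (g i)) * det (mat s s (\<lambda>(i,j). Y (g j) (f i))))"
      by (rule det_rows_expansion)
    also have "\<dots> = (\<Sum>f\<in>tuples s m. (\<Prod>i<s. X (f i) (g i)) * det (mat s s (\<lambda>(i,j). Y (g i) (f j))))"
      by (intro sum.cong refl arg_cong2[of _ _ _ _ "(*)"]) (rule det_mat_transpose)
    finally show "(\<Sum>f\<in>tuples s m. (\<Prod>i<s. X (f i) (g i)) * det (mat s s (\<lambda>(i,j). Y (g i) (f j))))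
        = det (mat s s (\<lambda>(i,j). \<Sum>k<m. Y (g i) k * X k (g j)))" by simp
  qed
  finally show ?thesis .
qed

section \<open>From sums over tuples to sums over subsets\<close>

lemma bij_betw_pick:
  assumes "finite J"
  shows "bij_betw (pick J) {0..<card J} J"
proof -
  have "inj_on (pick J) {0..<card J}"
    by (rule linorder_inj_onI) (use pick_mono_le in fastforce)+
  moreover have "pick J ` {0..<card J} \<subseteq> J" using pick_in_set_le by auto
  ultimately show ?thesis
    using assms by (simp add: bij_betw_def card_image card_subset_eq)
qed

text \<open>An injective tuple with image \<open>J\<close> is the increasing enumeration of
  \<open>J\<close> preceded by a permutation of the positions, so each \<open>J\<close> is hit
  \<open>fact s\<close> times.\<close>

lemma sum_tuples_eq_sum_subsets:
  fixes G :: "(nat \<Rightarrow> nat) \<Rightarrow> real"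
  assumes noninj: "\<And>f. f \<in> tuples s n \<Longrightarrow> \<not> inj_on f {0..<s} \<Longrightarrow> G f = 0"
    and inj: "\<And>f. f \<in> tuples s n \<Longrightarrow> inj_on f {0..<s} \<Longrightarrow> G f = H (f ` {0..<s})"
  shows "(\<Sum>f\<in>tuples s n. G f) = fact s * (\<Sum>J\<in>subsets_s n s. H J)"
proof -
  let ?I = "{f \<in> tuples s n. inj_on f {0..<s}}"
  have finI: "finite ?I" using finite_tuples by simp
  have im: "(\<lambda>f. f ` {0..<s}) ` ?I \<subseteq> subsets_s n s"
    by (auto simp: subsets_s_def tuples_def card_image)
  have card: "card {f \<in> ?I. f ` {0..<s} = J} = fact s" if J: "J \<in> subsets_s n s" for J
  proof -
    have J': "finite J" "card J = s" "J \<subseteq> {0..<n}"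
      using J finite_subset by (auto simp: subsets_s_def)
    from bij_betw_pick[OF J'(1)] J'(2) have pick: "bij_betw (pick J) {0..<s} J" by simp
    let ?h = "\<lambda>p i. if i < s then pick J (p i) else i"
    have "bij_betw ?h {p. p permutes {0..<s}} {f \<in> ?I. f ` {0..<s} = J}"
    proof (rule bij_betwI')
      fix p q assume pq: "p \<in> {p. p permutes {0..<s}}" "q \<in> {p. p permutes {0..<s}}"
      show "?h p = ?h q \<longleftrightarrow> p = q"
      proof
        assume eq: "?h p = ?h q"
        show "p = q"
        proof
          fix i
          show "p i = q i"
          proof (cases "i < s")
            case True
            hence "pick J (p i) = pick J (q i)" using fun_cong[OF eq, of i] by simp
            moreover have "p i \<in> {0..<s}" "q i \<in> {0..<s}"
              using True pq by (auto simp: permutes_in_image[of _ "{0..<s}", simplified])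
            ultimately show ?thesis using pick by (auto simp: bij_betw_def inj_on_def)
          next
            case False
            thus ?thesis using pq by (simp add: permutes_not_in)
          qed
        qed
      next
        assume "p = q" thus "?h p = ?h q" by (rule arg_cong)
      qed
    next
      fix p assume "p \<in> {p. p permutes {0..<s}}"
      hence p: "p permutes {0..<s}" by simp
      have "bij_betw (pick J \<circ> p) {0..<s} J"
        by (rule bij_betw_trans[OF permutes_imp_bij[OF p] pick])
      hence b: "bij_betw (?h p) {0..<s} J" by (rule bij_betw_cong[THEN iffD1, rotated]) auto
      hence "?h p ` {0..<s} = J" "inj_on (?h p) {0..<s}" by (simp_all add: bij_betw_def)
      moreover have "?h p \<in> tuples s n"
        using bij_betw_apply[OF b] J'(3) unfolding tuples_def by fastforce
      ultimately show "?h p \<in> {f \<in> ?I. f ` {0..<s} = J}" by simp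
    next
      fix f assume f: "f \<in> {f \<in> ?I. f ` {0..<s} = J}"
      let ?p = "\<lambda>i. if i < s then inv_into {0..<s} (pick J) (f i) else i"
      have "bij_betw f {0..<s} J" using f by (simp add: bij_betw_def)
      from bij_betw_trans[OF this bij_betw_inv_into[OF pick]]
      have "bij_betw ?p {0..<s} {0..<s}" by (rule bij_betw_cong[THEN iffD1, rotated]) auto
      hence "?p permutes {0..<s}" by (rule bij_imp_permutes) auto
      moreover have "f = ?h ?p"
      proof
        fix i show "f i = ?h ?p i"
        proof (cases "i < s")
          case True
          hence "f i \<in> pick J ` {0..<s}" using f pick by (auto simp: bij_betw_def)
          thus ?thesis using True by (simp add: f_inv_into_f)
        next
          case False
          thus ?thesis using f by (simp add: tuples_def)
        qed
      qed
      ultimately show "\<exists>p\<in>{p. p permutes {0..<s}}. f = ?h p"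
        by (intro bexI[of _ ?p] CollectI)
    qed
    from bij_betw_same_card[OF this] show ?thesis by (simp add: card_permutations[of _ s])
  qed
  have "(\<Sum>f\<in>tuples s n. G f) = (\<Sum>f\<in>?I. G f)"
    by (rule sum.mono_neutral_right) (use finite_tuples noninj in auto)
  also have "\<dots> = (\<Sum>f\<in>?I. H (f ` {0..<s}))"
    by (rule sum.cong) (use inj in auto)
  also have "\<dots> = (\<Sum>J\<in>subsets_s n s. \<Sum>f\<in>{f\<in>?I. f ` {0..<s} = J}. H (f ` {0..<s}))"
    by (rule sum.group[OF finI finite_subsets_s im, symmetric])
  also have "\<dots> = (\<Sum>J\<in>subsets_s n s. fact s * H J)"
  proof (rule sum.cong[OF refl])
    fix J assume J: "J \<in> subsets_s n s"
    have "(\<Sum>f\<in>{f\<in>?I. f ` {0..<s} = J}. H (f ` {0..<s})) = (\<Sum>f\<in>{f\<in>?I. f ` {0..<s} = J}. H J)"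
      by (rule sum.cong) auto
    thus "(\<Sum>f\<in>{f\<in>?I. f ` {0..<s} = J}. H (f ` {0..<s})) = fact s * H J"
      by (simp only: sum_constant card[OF J] of_nat_fact)
  qed
  finally show ?thesis by (simp add: sum_distrib_left)
qed

text \<open>Rows and columns are permuted alike, so the sign of \<open>p\<close> enters twice and
  cancels.\<close>

lemma det_permute_principal:
  fixes F :: "nat \<Rightarrow> nat \<Rightarrow> 'a :: comm_ring_1"
  assumes p: "p permutes {0..<s}"
  shows "det (mat s s (\<lambda>(i,j). F (p i) (p j))) = det (mat s s (\<lambda>(i,j). F i j))"
proof -
  have ps: "p i < s" if "i < s" for i using permutes_in_image[OF p, of i] that by simp
  have rows: "det (mat s s (\<lambda>(i,j). K (p i) j)) = signof p * det (mat s s (\<lambda>(i,j). K i j))"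
    for K :: "nat \<Rightarrow> nat \<Rightarrow> 'a"
  proof -
    have "mat s s (\<lambda>(i,j). K (p i) j) = mat s s (\<lambda>(i,j). mat s s (\<lambda>(i,j). K i j) $$ (p i, j))"
      by (rule eq_matI) (auto simp: ps)
    thus ?thesis using det_permute_rows[OF mat_carrier p] by simp
  qed
  have "det (mat s s (\<lambda>(i,j). F (p i) (p j))) = signof p * det (mat s s (\<lambda>(i,j). F i (p j)))"
    by (rule rows)
  also have "det (mat s s (\<lambda>(i,j). F i (p j))) = det (mat s s (\<lambda>(i,j). F j (p i)))"
    by (rule det_mat_transpose)
  also have "\<dots> = signof p * det (mat s s (\<lambda>(i,j). F j i))" by (rule rows)
  also have "det (mat s s (\<lambda>(i,j). F j i)) = det (mat s s (\<lambda>(i,j). F i j))"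
    by (rule det_mat_transpose)
  finally show ?thesis by (simp add: mult.assoc[symmetric] sign_def)
qed

text \<open>The matrix is given by its entry function, so products written as entrywise sums can be
  inserted directly.\<close>

definition principal_minor :: "(nat \<Rightarrow> nat \<Rightarrow> real) \<Rightarrow> nat set \<Rightarrow> real" where
  "principal_minor M J = det (mat (card J) (card J) (\<lambda>(i,j). M (pick J i) (pick J j)))"

text \<open>\<open>f\<close> differs from the increasing enumeration of its image by a permutation,
  which leaves principal minors unchanged.\<close>

lemma det_tuple_inj:
  assumes inj: "inj_on f {0..<s}"
  shows "det (mat s s (\<lambda>(i,j). M (f i) (f j))) = principal_minor M (f ` {0..<s})"
proof -
  let ?J = "f ` {0..<s}"
  have card: "card ?J = s" using inj by (simp add: card_image)
  have pick: "bij_betw (pick ?J) {0..<s} ?J" using bij_betw_pick[of ?J] card by simp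
  define p where "p i = (if i < s then inv_into {0..<s} (pick ?J) (f i) else i)" for i
  have "bij_betw f {0..<s} ?J" using inj by (simp add: bij_betw_def)
  from bij_betw_trans[OF this bij_betw_inv_into[OF pick]]
  have "bij_betw p {0..<s} {0..<s}"
    by (rule bij_betw_cong[THEN iffD1, rotated]) (auto simp: p_def)
  hence p: "p permutes {0..<s}" by (rule bij_imp_permutes) (auto simp: p_def)
  have fp: "f i = pick ?J (p i)" if "i < s" for i
  proof -
    have "f i \<in> pick ?J ` {0..<s}" using pick that by (auto simp: bij_betw_def)
    thus ?thesis using that by (simp add: p_def f_inv_into_f)
  qed
  have "mat s s (\<lambda>(i,j). M (f i) (f j)) = mat s s (\<lambda>(i,j). M (pick ?J (p i)) (pick ?J (p j)))"
    by (rule eq_matI) (simp_all add: fp[symmetric])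
  also have "det \<dots> = det (mat s s (\<lambda>(i,j). M (pick ?J i) (pick ?J j)))"
    by (rule det_permute_principal[OF p])
  finally show ?thesis by (simp add: principal_minor_def card)
qed

lemma det_tuple_not_inj:
  assumes "\<not> inj_on f {0..<s}"
  shows "det (mat s s (\<lambda>(i,j). M (f i) (f j))) = (0 :: 'a :: comm_ring_1)"
proof -
  from assms obtain i j where "i < s" "j < s" "i \<noteq> j" "f i = f j" by (auto simp: inj_on_def)
  thus ?thesis by (intro det_identical_rows[of _ s i j]) (auto intro!: eq_vecI)
qed

text \<open>The tuple identity with the common factor \<open>fact s\<close> cancelled. It trades
  sums over row subsets of \<open>A\<close> for sums over sets of singular indices.\<close>

lemma sum_principal_minors_commute:
  "(\<Sum>J\<in>subsets_s m s. principal_minor (\<lambda>i j. \<Sum>k<n. X i k * Y k j) J) =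
   (\<Sum>J\<in>subsets_s n s. principal_minor (\<lambda>i j. \<Sum>k<m. Y i k * X k j) J)"
proof -
  have *: "(\<Sum>f\<in>tuples s N. det (mat s s (\<lambda>(i,j). M (f i) (f j)))) =
      fact s * (\<Sum>J\<in>subsets_s N s. principal_minor M J)" for M N
    by (rule sum_tuples_eq_sum_subsets) (auto simp: det_tuple_inj det_tuple_not_inj)
  from sum_det_tuples_commute[where s = s and m = m and n = n and X = X and Y = Y] show ?thesis
    using *[of "\<lambda>i j. \<Sum>k<n. X i k * Y k j" m] *[of "\<lambda>i j. \<Sum>k<m. Y i k * X k j" n] by simp
qed

section \<open>Row submatrices and their entries\<close>

lemma pick_atLeastLessThan:
  assumes "j < n"
  shows "pick {0..<n} j = j"
proof -
  have eq: "{a. a < n \<and> a \<in> UNIV} = {0..<n}" by auto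
  show ?thesis using pick_reduce_set[of j n UNIV] assms unfolding eq by (simp add: pick_UNIV)
qed

lemma row_sub_carrier:
  assumes "A \<in> carrier_mat m n" "S \<in> subsets_s m s"
  shows "row_sub A S \<in> carrier_mat s n"
proof -
  have "{i. i < m \<and> i \<in> S} = S" "{j. j < n \<and> j \<in> {0..<n}} = {0..<n}"
    using assms by (auto simp: subsets_s_def)
  thus ?thesis using assms by (auto simp: row_sub_def submatrix_def subsets_s_def)
qed

lemma row_sub_index:
  assumes "A \<in> carrier_mat m n" "S \<in> subsets_s m s" "i < s" "j < n"
  shows "row_sub A S $$ (i,j) = A $$ (pick S i, j)"
proof -
  have "{i. i < m \<and> i \<in> S} = S" "{j. j < n \<and> j \<in> {0..<n}} = {0..<n}" "card S = s"
    using assms by (auto simp: subsets_s_def)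
  thus ?thesis using assms
    by (simp add: row_sub_def submatrix_index pick_atLeastLessThan)
qed

lemma pick_subsets_s:
  assumes "S \<in> subsets_s m s" "i < s"
  shows "pick S i < m"
  using assms pick_in_set_le[of i S] by (auto simp: subsets_s_def)

lemma row_row_sub:
  assumes A: "A \<in> carrier_mat m n" and S: "S \<in> subsets_s m s" and i: "i < s"
  shows "row (row_sub A S) i = row A (pick S i)"
  using A row_sub_carrier[OF A S] row_sub_index[OF A S i] pick_subsets_s[OF S i] i
  by (intro eq_vecI) auto

lemma vec_sub_mult:
  assumes A: "A \<in> carrier_mat m n" and S: "S \<in> subsets_s m s" and x: "x \<in> carrier_vec n"
  shows "vec_sub (A *\<^sub>v x) S = row_sub A S *\<^sub>v x"
proof -
  have S': "{i. i < m \<and> i \<in> S} = S" "card S = s" using S by (auto simp: subsets_s_def)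
  show ?thesis
    using A row_sub_carrier[OF A S] S' pick_subsets_s[OF S]
    by (intro eq_vecI) (auto simp: vec_sub_def row_row_sub[OF A S])
qed

lemma principal_minor_cong:
  assumes "J \<in> subsets_s n s" "\<And>i j. i < n \<Longrightarrow> j < n \<Longrightarrow> M i j = N i j"
  shows "principal_minor M J = principal_minor N J"
proof -
  have "card J = s" using assms by (simp add: subsets_s_def)
  thus ?thesis unfolding principal_minor_def
    by (intro arg_cong[of _ _ det] eq_matI) (auto intro!: assms(2) pick_subsets_s[OF assms(1)])
qed

text \<open>The factor \<open>d\<close> scales whole columns and comes out as
  \<open>prod d J\<close>; what remains is a rank-one update of the identity. Transposing lets the
  row rule for determinants act on columns.\<close>

lemma principal_minor_rank_one_diag:
  assumes J: "J \<in> subsets_s n s"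
  shows "principal_minor (\<lambda>i j. ((if i = j then 1 else 0) + t * y i * y j) * d j) J =
    prod d J * (1 + t * (\<Sum>i\<in>J. (y i)\<^sup>2))"
proof -
  have J': "finite J" "card J = s" using J finite_subset by (auto simp: subsets_s_def)
  have bij: "bij_betw (pick J) {0..<s} J" using bij_betw_pick[OF J'(1)] J'(2) by simp
  have eq: "pick J i = pick J j \<longleftrightarrow> i = j" if "i < s" "j < s" for i j
    using bij that by (auto simp: bij_betw_def inj_on_def)
  define u where "u = vec s (\<lambda>i. t * y (pick J i))"
  define v where "v = vec s (\<lambda>i. y (pick J i))"
  have uv: "u \<in> carrier_vec s" "v \<in> carrier_vec s" by (auto simp: u_def v_def)
  let ?F = "\<lambda>i j. (if i = j then 1 else 0) + u $ i * v $ j"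
  have "principal_minor (\<lambda>i j. ((if i = j then 1 else 0) + t * y i * y j) * d j) J
      = det (mat s s (\<lambda>(i,j). d (pick J j) * ?F i j))"
    unfolding principal_minor_def J'(2)
    by (intro arg_cong[of _ _ det] eq_matI) (auto simp: eq u_def v_def)
  also have "\<dots> = det (mat s s (\<lambda>(i,j). d (pick J i) * ?F j i))"
    by (rule det_mat_transpose)
  also have "mat s s (\<lambda>(i,j). d (pick J i) * ?F j i)
      = mat\<^sub>r s s (\<lambda>i. d (pick J i) \<cdot>\<^sub>v vec s (\<lambda>j. ?F j i))"
    by (rule eq_matI) auto
  also have "det \<dots> = prod (\<lambda>i. d (pick J i)) {0..<s} * det (mat\<^sub>r s s (\<lambda>i. vec s (\<lambda>j. ?F j i)))"
    by (rule det_rows_mul) auto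
  also have "mat\<^sub>r s s (\<lambda>i. vec s (\<lambda>j. ?F j i)) = mat s s (\<lambda>(i,j). ?F j i)"
    by (rule eq_matI) auto
  also have "det (mat s s (\<lambda>(i,j). ?F j i)) = det (mat s s (\<lambda>(i,j). ?F i j))"
    by (rule det_mat_transpose)
  also have "\<dots> = 1 + v \<bullet> u" by (rule det_one_plus_rank_one[OF uv])
  also have "v \<bullet> u = t * (\<Sum>i\<in>{0..<s}. (y (pick J i))\<^sup>2)"
    by (simp add: scalar_prod_def u_def v_def sum_distrib_left power2_eq_square mult_ac)
  also have "(\<Sum>i\<in>{0..<s}. (y (pick J i))\<^sup>2) = (\<Sum>i\<in>J. (y i)\<^sup>2)"
    by (rule sum.reindex_bij_betw[OF bij])
  also have "prod (\<lambda>i. d (pick J i)) {0..<s} = prod d J"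
    by (rule prod.reindex_bij_betw[OF bij])
  finally show ?thesis .
qed

text \<open>With \<open>G = R R\<^sup>T\<close>, \<open>u = R x\<close> and \<open>w = X\<^sup>T x\<close> the pseudoinverse equations give \<open>G w = u\<close>
  even if \<open>G\<close> is singular, so \<open>G + u u\<^sup>T = G (1 + w u\<^sup>T)\<close>.\<close>

lemma det_gram_plus_rank_one:
  fixes R X :: "real mat"
  assumes R: "R \<in> carrier_mat s n" and pinv: "is_pinv R X" and x: "x \<in> carrier_vec n"
  shows "det (mat s s (\<lambda>(i,j). row R i \<bullet> row R j + (R *\<^sub>v x) $ i * (R *\<^sub>v x) $ j)) =
    det (R * transpose_mat R) * (1 + x \<bullet> ((X * R) *\<^sub>v x))"
proof -
  from pinv R have X: "X \<in> carrier_mat n s" and RXR: "R * X * R = R"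
    and sym: "transpose_mat (X * R) = X * R" unfolding is_pinv_def by auto
  have Rt: "transpose_mat R \<in> carrier_mat n s" and Xt: "transpose_mat X \<in> carrier_mat s n"
    using R X by auto
  define u where "u = R *\<^sub>v x"
  define w where "w = transpose_mat X *\<^sub>v x"
  define G where "G = R * transpose_mat R"
  have G: "G \<in> carrier_mat s s" unfolding G_def using R by auto
  have Gij: "G $$ (i,j) = row R i \<bullet> row R j" if "i < s" "j < s" for i j
    using R that unfolding G_def by simp
  have u: "u \<in> carrier_vec s" and w: "w \<in> carrier_vec s" unfolding u_def w_def using R Xt x by auto
  \<comment> \<open>The transpose of \<open>X * R\<close> applied to \<open>x\<close>, rewritten by
    the symmetry of \<open>X * R\<close>.\<close>
  have Px: "transpose_mat R *\<^sub>v w = (X * R) *\<^sub>v x"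
    unfolding w_def using sym R X Xt Rt x by (metis assoc_mult_mat_vec transpose_mult)
  have "G *\<^sub>v w = R *\<^sub>v (transpose_mat R *\<^sub>v w)" unfolding G_def using R Rt w by (simp add: assoc_mult_mat_vec[of _ s n _ s])
  also have "\<dots> = (R * X * R) *\<^sub>v x" unfolding Px using R X x
    by (simp add: assoc_mult_mat_vec[of _ s n _ n] assoc_mult_mat_vec[of _ n s _ n] assoc_mult_mat_vec[of _ s s _ n]
        assoc_mult_mat_vec[of _ s n _ s])
  also have "\<dots> = u" unfolding RXR u_def ..
  finally have Gw: "G *\<^sub>v w = u" .
  have uw: "u \<bullet> w = x \<bullet> ((X * R) *\<^sub>v x)"
    unfolding Px[symmetric] u_def using transpose_vec_mult_scalar[OF Rt w x] by simp
  let ?B = "mat s s (\<lambda>(i,j). (if i = j then 1 else 0) + w $ i * u $ j)"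
  have "mat s s (\<lambda>(i,j). row R i \<bullet> row R j + u $ i * u $ j) = G * ?B"
  proof (rule eq_matI)
    fix i j assume "i < dim_row (G * ?B)" "j < dim_col (G * ?B)"
    hence ij: "i < s" "j < s" using G by auto
    have ui: "u $ i = (\<Sum>k<s. G $$ (i,k) * w $ k)"
      using arg_cong[OF Gw, of "\<lambda>v. v $ i"] G w ij by (simp add: scalar_prod_def atLeast0LessThan)
    have "(G * ?B) $$ (i,j) = (\<Sum>k<s. G $$ (i,k) * ((if k = j then 1 else 0) + w $ k * u $ j))"
      using ij G by (simp add: scalar_prod_def atLeast0LessThan)
    also have "\<dots> = (\<Sum>k<s. (if k = j then G $$ (i,k) else 0) + G $$ (i,k) * w $ k * u $ j)"
      by (intro sum.cong refl) (simp add: algebra_simps)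
    also have "\<dots> = G $$ (i,j) + u $ i * u $ j"
      unfolding ui sum.distrib sum_distrib_right using ij by simp
    finally show "mat s s (\<lambda>(i,j). row R i \<bullet> row R j + u $ i * u $ j) $$ (i,j) = (G * ?B) $$ (i,j)"
      using ij by (simp add: Gij)
  qed (use G in auto)
  moreover have "det ?B = 1 + u \<bullet> w" by (rule det_one_plus_rank_one[OF w u])
  ultimately show ?thesis using det_mult[OF G, of ?B] by (simp add: u_def[symmetric] uw G_def)
qed

section \<open>The eigenvalue bound\<close>

text \<open>The map \<open>J \<mapsto> (max J, J)\<close> if \<open>i \<in> J\<close> and \<open>J \<mapsto> (max J, J - {max J} \<union> {i})\<close> otherwise is an
  injection of the \<open>s\<close>-subsets into the index pairs of the product on the right, and
  it does not decrease the summands.\<close>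

lemma marginal_weight_lower_bound:
  fixes d :: "nat \<Rightarrow> real"
  assumes desc: "\<And>i j. i \<le> j \<Longrightarrow> j < n \<Longrightarrow> d j \<le> d i"
    and pos: "\<And>i. i < r \<Longrightarrow> d i > 0"
    and zero: "\<And>i. r \<le> i \<Longrightarrow> i < n \<Longrightarrow> d i = 0"
    and rn: "r \<le> n" and s: "1 \<le> s" and i: "i < r"
  shows "d (r - 1) * (\<Sum>J\<in>subsets_s n s. prod d J) \<le>
    (\<Sum>l = s - 1..<r. d l) * (\<Sum>J\<in>{J\<in>subsets_s n s. i \<in> J}. prod d J)"
proof -
  have nonneg: "d l \<ge> 0" if "l < n" for l using that pos[of l] zero[of l] by (cases "l < r") auto
  define h where "h J = (if i \<in> J then (Max J, J) else (Max J, insert i (J - {Max J})))" for J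
  define g where "g = (\<lambda>(l, K). d l * prod d K)"
  let ?K = "{J\<in>subsets_s n s. i \<in> J}"
  have J: "finite J" "J \<noteq> {}" "J \<subseteq> {0..<r}" "card J = s" "Max J \<in> J" "Max J < r" "s - 1 \<le> Max J"
    if "J \<in> subsets_s r s" for J
  proof -
    show 1: "finite J" "J \<subseteq> {0..<r}" "card J = s" using that finite_subset by (auto simp: subsets_s_def)
    show 2: "J \<noteq> {}" using 1(3) s by auto
    show 3: "Max J \<in> J" using 1(1) 2 by simp
    show "Max J < r" using 3 1(2) by auto
    \<comment> \<open>An \<open>s\<close>-set of naturals has maximum at least \<open>s - 1\<close>;
      hence the sum of the \<open>d l\<close> may start there, which is the 0-based index of
      sigma_s.\<close>
    have "J \<subseteq> {0..Max J}" using 1(1) by auto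
    from card_mono[OF _ this] show "s - 1 \<le> Max J" using 1(3) by simp
  qed
  have inj: "inj_on h (subsets_s r s)"
  proof (rule inj_onI)
    fix J L assume JL: "J \<in> subsets_s r s" "L \<in> subsets_s r s" and eq: "h J = h L"
    have max: "Max J = Max L" using eq by (auto simp: h_def split: if_splits)
    \<comment> \<open>The stored maximum lies in the stored set exactly if \<open>i\<close> was in
      the original set, so the two branches of \<open>h\<close> have disjoint images.\<close>
    have *: "i \<in> M \<longleftrightarrow> fst (h M) \<in> snd (h M)" if "M \<in> subsets_s r s" for M
      using J(5)[OF that] by (auto simp: h_def)
    show "J = L"
    proof (cases "i \<in> J")
      case True
      with * JL eq have "i \<in> L" by metis
      thus ?thesis using True eq by (simp add: h_def)
    next
      case False
      with * JL eq have L: "i \<notin> L" by metis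
      have "insert i (J - {Max J}) = insert i (L - {Max L})" using False L eq by (auto simp: h_def)
      hence "J - {Max J} = L - {Max L}" using False L by (subst (asm) insert_ident) auto
      thus ?thesis using max J(5)[OF JL(1)] J(5)[OF JL(2)] by (metis insert_Diff)
    qed
  qed
  have im: "h ` subsets_s r s \<subseteq> {s - 1..<r} \<times> ?K"
  proof
    fix x assume "x \<in> h ` subsets_s r s"
    then obtain M where M: "M \<in> subsets_s r s" and x: "x = h M" by auto
    note M' = J[OF M]
    show "x \<in> {s - 1..<r} \<times> ?K"
    proof (cases "i \<in> M")
      case True
      thus ?thesis using M' rn unfolding x by (auto simp: h_def subsets_s_def)
    next
      case False
      hence "card (insert i (M - {Max M})) = s" using M'(1,4,5) s by simp
      moreover have "insert i (M - {Max M}) \<subseteq> {0..<n}" using M'(3) rn i by auto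
      ultimately show ?thesis using False M'(6,7) unfolding x by (auto simp: h_def subsets_s_def)
    qed
  qed
  \<comment> \<open>If \<open>i\<close> is in \<open>M\<close>, the extra factor
    \<open>d (r - 1)\<close> grows to \<open>d (Max M)\<close>; otherwise it grows to
    \<open>d i\<close>, and \<open>d (Max M)\<close> moves to the first component.\<close>
  have le: "d (r - 1) * prod d M \<le> g (h M)" if M: "M \<in> subsets_s r s" for M
  proof -
    note M' = J[OF M]
    have d0: "prod d (M - {Max M}) \<ge> 0" "prod d M \<ge> 0"
      using M'(3) rn by (auto intro!: prod_nonneg nonneg)
    show ?thesis
    proof (cases "i \<in> M")
      case True
      have "d (r - 1) \<le> d (Max M)" using desc[of "Max M" "r - 1"] M'(6) rn i by auto
      thus ?thesis using True d0 by (simp add: h_def g_def mult_right_mono)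
    next
      case False
      have "d (r - 1) \<le> d i" using desc[of i "r - 1"] rn i by auto
      moreover have "prod d M = d (Max M) * prod d (M - {Max M})"
        using M'(1,5) by (rule prod.remove)
      moreover have "d (Max M) \<ge> 0" using M'(6) rn by (intro nonneg) auto
      ultimately have "d (r - 1) * prod d M \<le> d i * (d (Max M) * prod d (M - {Max M}))"
        using d0 pos[OF i] by (intro mult_mono) auto
      thus ?thesis using False M'(1) by (simp add: h_def g_def mult_ac)
    qed
  qed
  \<comment> \<open>A set that reaches beyond the first \<open>r\<close> indices contains a zero
    factor.\<close>
  have "(\<Sum>J\<in>subsets_s n s. prod d J) = (\<Sum>J\<in>subsets_s r s. prod d J)"
  proof (rule sum.mono_neutral_right[OF finite_subsets_s])
    show "subsets_s r s \<subseteq> subsets_s n s" using rn by (auto simp: subsets_s_def)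
    show "\<forall>J\<in>subsets_s n s - subsets_s r s. prod d J = 0"
    proof
      fix M assume M: "M \<in> subsets_s n s - subsets_s r s"
      then obtain l where "l \<in> M" "r \<le> l" "l < n" by (fastforce simp: subsets_s_def)
      moreover have "finite M" using M finite_subset by (auto simp: subsets_s_def)
      ultimately show "prod d M = 0" using zero by (meson prod_zero)
    qed
  qed
  hence "d (r - 1) * (\<Sum>J\<in>subsets_s n s. prod d J) = (\<Sum>J\<in>subsets_s r s. d (r - 1) * prod d J)"
    by (simp add: sum_distrib_left)
  also have "\<dots> \<le> (\<Sum>J\<in>subsets_s r s. g (h J))" by (rule sum_mono[OF le])
  also have "\<dots> = sum g (h ` subsets_s r s)" using sum.reindex[OF inj, of g] by simp
  also have "\<dots> \<le> sum g ({s - 1..<r} \<times> ?K)"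
  proof (rule sum_mono2[OF _ im])
    show "finite ({s - 1..<r} \<times> ?K)" using finite_subsets_s by simp
    fix x assume "x \<in> {s - 1..<r} \<times> ?K - h ` subsets_s r s"
    thus "0 \<le> g x" using rn
      by (auto simp: g_def subsets_s_def subset_iff intro!: mult_nonneg_nonneg prod_nonneg nonneg)
  qed
  also have "\<dots> = (\<Sum>l = s - 1..<r. d l) * (\<Sum>J\<in>?K. prod d J)"
    by (simp add: g_def sum_product sum.cartesian_product)
  finally show ?thesis .
qed

section \<open>The mean of the projections\<close>

text \<open>The assumptions on \<open>V\<close> and \<open>sing_sq\<close> are those delivered by
  \<open>ex_right_singular_basis\<close>; the basis stays fixed for the whole analysis.\<close>

locale volume_sampling =
  fixes A V :: "real mat" and m n s :: nat
  assumes A: "A \<in> carrier_mat m n" and V: "V \<in> carrier_mat n n"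
    and VtV: "transpose_mat V * V = 1\<^sub>m n"
    and orth: "\<And>i j. i < n \<Longrightarrow> j < n \<Longrightarrow>
      col (A * V) i \<bullet> col (A * V) j = (if i = j then sing_sq A i else 0)"
    and desc: "\<And>i j. i \<le> j \<Longrightarrow> j < n \<Longrightarrow> sing_sq A j \<le> sing_sq A i"
    and nonneg: "\<And>i. i < n \<Longrightarrow> sing_sq A i \<ge> 0"
    and pos: "\<And>i. i < n \<Longrightarrow> sing_sq A i > 0 \<longleftrightarrow> i < mat_rank A"
    and rank_le: "mat_rank A \<le> n"
    and s1: "1 \<le> s" and sr: "s \<le> mat_rank A"
begin

abbreviation "d \<equiv> sing_sq A"
abbreviation "R S \<equiv> row_sub A S"
abbreviation "proj S \<equiv> pinv (R S) * R S"
abbreviation "gram S \<equiv> det (R S * transpose_mat (R S))"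
abbreviation "total_weight \<equiv> \<Sum>J\<in>subsets_s n s. prod d J"

text \<open>The eigenvalue of the mean projection belonging to the right singular vector \<open>col V i\<close>.\<close>

definition lam :: "nat \<Rightarrow> real" where
  "lam i = (\<Sum>J\<in>{J\<in>subsets_s n s. i \<in> J}. prod d J) / total_weight"

section \<open>Coordinates in the right singular basis\<close>

lemma VVt: "V * transpose_mat V = 1\<^sub>m n"
  using mat_mult_left_right_inverse[OF _ V VtV] V by simp

lemma col_V [simp]: "col V i \<in> carrier_vec n"
  using V by auto

lemma col_V_prod: "i < n \<Longrightarrow> j < n \<Longrightarrow> col V i \<bullet> col V j = (if i = j then 1 else 0)"
  using arg_cong[OF VtV, of "\<lambda>M. M $$ (i,j)"] V by simp

lemma parseval:
  assumes e: "e \<in> carrier_vec n"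
  shows "e \<bullet> e = (\<Sum>i<n. (col V i \<bullet> e)\<^sup>2)"
proof -
  have Vt: "transpose_mat V \<in> carrier_mat n n" using V by simp
  have "(transpose_mat V *\<^sub>v e) \<bullet> (transpose_mat V *\<^sub>v e) = e \<bullet> (V *\<^sub>v (transpose_mat V *\<^sub>v e))"
    using V Vt e by (intro transpose_vec_mult_scalar) auto
  also have "V *\<^sub>v (transpose_mat V *\<^sub>v e) = e"
    using assoc_mult_mat_vec[OF V Vt e] VVt e by simp
  finally have "e \<bullet> e = (\<Sum>i<n. ((transpose_mat V *\<^sub>v e) $ i)\<^sup>2)"
    using real_scalar_prod_self[of "transpose_mat V *\<^sub>v e" n] Vt e by simp
  thus ?thesis using V by simp
qed

text \<open>The left side sums principal minors of
  \<open>A (I + t x x^T) A^T = W (I + t y y^T) W^T\<close>, where \<open>W = A * V\<close> and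
  \<open>y = V^T x\<close>. Moving the first \<open>W\<close> to the end leaves
  \<open>(I + t y y^T) D\<close> with \<open>D\<close> diagonal, whose minors are explicit.\<close>

lemma sum_det_gram_rank_one:
  assumes x: "x \<in> carrier_vec n"
  shows "(\<Sum>S\<in>subsets_s m s. det (mat s s (\<lambda>(i,j).
      row (R S) i \<bullet> row (R S) j + t * ((R S *\<^sub>v x) $ i * (R S *\<^sub>v x) $ j)))) =
    (\<Sum>J\<in>subsets_s n s. prod d J * (1 + t * (\<Sum>i\<in>J. (col V i \<bullet> x)\<^sup>2)))"
proof -
  define W where "W = A * V"
  have W: "W \<in> carrier_mat m n" unfolding W_def using A V by simp
  have Vt: "transpose_mat V \<in> carrier_mat n n" using V by simp
  define y where "y i = col V i \<bullet> x" for i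
  define z where "z = A *\<^sub>v x"
  \<comment> \<open>\<open>Y\<close> is \<open>(I + t y y^T) W^T\<close>, since
    \<open>z = A x = W y\<close>.\<close>
  define Y where "Y p j = W $$ (j,p) + t * y p * z $ j" for p j
  have AW: "A = W * transpose_mat V"
    unfolding W_def using A V Vt by (simp add: assoc_mult_mat[of _ m n _ n _ n] VVt)
  have "A * transpose_mat A = W * ((transpose_mat V * V) * transpose_mat W)"
    using W V Vt unfolding AW
    by (simp add: transpose_mult[of _ m n _ n] assoc_mult_mat[of _ m n _ n _ m] assoc_mult_mat[of _ n n _ n _ m])
  hence AAt: "A * transpose_mat A = W * transpose_mat W" unfolding VtV using W by simp
  have AA: "row A k \<bullet> row A l = (\<Sum>p<n. W $$ (k,p) * W $$ (l,p))" if "k < m" "l < m" for k l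
    using arg_cong[OF AAt, of "\<lambda>M. M $$ (k,l)"] that A W
    by (simp add: scalar_prod_def atLeast0LessThan)
  have "z = W *\<^sub>v (transpose_mat V *\<^sub>v x)"
    unfolding z_def using assoc_mult_mat_vec[OF W Vt x] AW by simp
  hence z: "z $ k = (\<Sum>p<n. W $$ (k,p) * y p)" if "k < m" for k
    using that W V x by (simp add: scalar_prod_def atLeast0LessThan y_def)
  have WW: "(\<Sum>k<m. W $$ (k,i) * W $$ (k,j)) = (if i = j then d i else 0)" if "i < n" "j < n" for i j
    using orth[OF that] W that unfolding W_def[symmetric] by (simp add: scalar_prod_def atLeast0LessThan)
  have zW: "(\<Sum>k<m. z $ k * W $$ (k,j)) = y j * d j" if j: "j < n" for j
  proof -
    have "(\<Sum>k<m. z $ k * W $$ (k,j)) = (\<Sum>k<m. \<Sum>p<n. y p * (W $$ (k,p) * W $$ (k,j)))"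
      by (intro sum.cong refl) (simp add: z sum_distrib_left mult_ac)
    also have "\<dots> = (\<Sum>p<n. y p * (\<Sum>k<m. W $$ (k,p) * W $$ (k,j)))"
      by (subst sum.swap) (simp add: sum_distrib_left)
    also have "\<dots> = (\<Sum>p<n. if p = j then y j * d j else 0)"
      using j by (intro sum.cong refl) (simp add: WW)
    finally show ?thesis using j by simp
  qed
  have "(\<Sum>S\<in>subsets_s m s. det (mat s s (\<lambda>(i,j).
        row (R S) i \<bullet> row (R S) j + t * ((R S *\<^sub>v x) $ i * (R S *\<^sub>v x) $ j))))
      = (\<Sum>S\<in>subsets_s m s. principal_minor (\<lambda>i j. \<Sum>p<n. W $$ (i,p) * Y p j) S)"
  proof (rule sum.cong[OF refl])
    fix S assume S: "S \<in> subsets_s m s"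
    have Rz: "(R S *\<^sub>v x) $ i = z $ pick S i" if "i < s" for i
      using that row_sub_carrier[OF A S] row_row_sub[OF A S that] A pick_subsets_s[OF S that]
      unfolding z_def by simp
    have "principal_minor (\<lambda>i j. \<Sum>p<n. W $$ (i,p) * Y p j) S
        = principal_minor (\<lambda>i j. row A i \<bullet> row A j + t * (z $ i * z $ j)) S"
    proof (rule principal_minor_cong[OF S])
      fix i j assume ij: "i < m" "j < m"
      have "(\<Sum>p<n. W $$ (i,p) * Y p j)
          = (\<Sum>p<n. W $$ (i,p) * W $$ (j,p)) + t * ((\<Sum>p<n. W $$ (i,p) * y p) * z $ j)"
        by (simp add: Y_def algebra_simps sum.distrib sum_distrib_left)
      thus "(\<Sum>p<n. W $$ (i,p) * Y p j) = row A i \<bullet> row A j + t * (z $ i * z $ j)"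
        using AA[OF ij] z[OF ij(1)] by simp
    qed
    also have "\<dots> = det (mat s s (\<lambda>(i,j). row (R S) i \<bullet> row (R S) j
        + t * ((R S *\<^sub>v x) $ i * (R S *\<^sub>v x) $ j)))"
    proof -
      have "card S = s" using S by (simp add: subsets_s_def)
      thus ?thesis unfolding principal_minor_def
        by (intro arg_cong[of _ _ det] eq_matI) (simp_all add: row_row_sub[OF A S] Rz del: index_mult_mat_vec)
    qed
    finally show "det (mat s s (\<lambda>(i,j). row (R S) i \<bullet> row (R S) j
        + t * ((R S *\<^sub>v x) $ i * (R S *\<^sub>v x) $ j)))
      = principal_minor (\<lambda>i j. \<Sum>p<n. W $$ (i,p) * Y p j) S" by simp
  qed
  also have "\<dots> = (\<Sum>J\<in>subsets_s n s. principal_minor (\<lambda>i j. \<Sum>k<m. Y i k * W $$ (k,j)) J)"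
    by (rule sum_principal_minors_commute)
  also have "\<dots> = (\<Sum>J\<in>subsets_s n s. prod d J * (1 + t * (\<Sum>i\<in>J. (y i)\<^sup>2)))"
  proof (rule sum.cong[OF refl])
    fix J assume J: "J \<in> subsets_s n s"
    have "principal_minor (\<lambda>i j. \<Sum>k<m. Y i k * W $$ (k,j)) J
        = principal_minor (\<lambda>i j. ((if i = j then 1 else 0) + t * y i * y j) * d j) J"
    proof (rule principal_minor_cong[OF J])
      fix i j assume ij: "i < n" "j < n"
      have "(\<Sum>k<m. Y i k * W $$ (k,j))
          = (\<Sum>k<m. W $$ (k,i) * W $$ (k,j)) + t * y i * (\<Sum>k<m. z $ k * W $$ (k,j))"
        by (simp add: Y_def algebra_simps sum.distrib sum_distrib_left)
      thus "(\<Sum>k<m. Y i k * W $$ (k,j)) = ((if i = j then 1 else 0) + t * y i * y j) * d j"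
        unfolding WW[OF ij] zW[OF ij(2)] by (simp add: algebra_simps)
    qed
    thus "principal_minor (\<lambda>i j. \<Sum>k<m. Y i k * W $$ (k,j)) J
        = prod d J * (1 + t * (\<Sum>i\<in>J. (y i)\<^sup>2))"
      using principal_minor_rank_one_diag[OF J] by simp
  qed
  finally show ?thesis unfolding y_def .
qed

text \<open>The rank-one identity at \<open>t = 0\<close>: the normalising sum is the elementary
  symmetric polynomial of degree \<open>s\<close> in the squared singular values.\<close>

lemma sum_gram: "(\<Sum>S\<in>subsets_s m s. gram S) = total_weight"
proof -
  have "gram S = det (mat s s (\<lambda>(i,j). row (R S) i \<bullet> row (R S) j))" if "S \<in> subsets_s m s" for S
    using row_sub_carrier[OF A that] by (intro arg_cong[of _ _ det] eq_matI) auto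
  thus ?thesis using sum_det_gram_rank_one[of "0\<^sub>v n" 0] by simp
qed

text \<open>The \<open>s\<close> leading indices contribute a positive term because \<open>s\<close>
  does not exceed the rank; so the normalisation of \<open>vol_prob\<close> is not a division by
  zero.\<close>

lemma total_pos: "total_weight > 0"
proof (rule sum_pos2[OF finite_subsets_s])
  show "{0..<s} \<in> subsets_s n s" using sr rank_le by (auto simp: subsets_s_def)
  show "0 < prod d {0..<s}" using sr rank_le pos by (intro prod_pos) auto
  show "0 \<le> prod d J" if "J \<in> subsets_s n s" for J
    using that nonneg by (intro prod_nonneg) (auto simp: subsets_s_def)
qed

lemma vol_prob_eq: "vol_prob A s S = gram S / total_weight"
  using sum_gram A by (simp add: vol_prob_def)

lemma sum_vol_prob: "(\<Sum>S\<in>subsets_s m s. vol_prob A s S) = 1"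
  unfolding vol_prob_eq using sum_gram total_pos by (simp add: sum_divide_distrib[symmetric])

lemma proj_carrier: "S \<in> subsets_s m s \<Longrightarrow> proj S \<in> carrier_mat n n"
  using row_sub_carrier[OF A, of S s] is_pinv_pinv[of "R S"] unfolding is_pinv_def
  by (intro mult_carrier_mat[of _ n s]) auto

lemma proj_sym: "transpose_mat (proj S) = proj S"
  using is_pinv_pinv[of "R S"] unfolding is_pinv_def by simp

text \<open>At \<open>t = 1\<close> each determinant is \<open>gram S\<close> times one plus the
  quadratic form of the projection. Subtracting \<open>sum_gram\<close> and collecting the terms by
  \<open>i\<close> gives the weights \<open>lam i\<close>.\<close>

lemma mean_proj_quadratic:
  assumes x: "x \<in> carrier_vec n"
  shows "(\<Sum>S\<in>subsets_s m s. vol_prob A s S * (x \<bullet> (proj S *\<^sub>v x))) = (\<Sum>i<n. lam i * (col V i \<bullet> x)\<^sup>2)"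
proof -
  let ?y = "\<lambda>i. (col V i \<bullet> x)\<^sup>2"
  have "(\<Sum>S\<in>subsets_s m s. gram S * (1 + x \<bullet> (proj S *\<^sub>v x)))
      = (\<Sum>J\<in>subsets_s n s. prod d J * (1 + (\<Sum>i\<in>J. ?y i)))"
    unfolding sum_det_gram_rank_one[OF x, of 1, simplified mult_1, symmetric]
    by (intro sum.cong refl det_gram_plus_rank_one[where n = n, symmetric] row_sub_carrier[OF A] is_pinv_pinv x)
  hence "(\<Sum>S\<in>subsets_s m s. gram S * (x \<bullet> (proj S *\<^sub>v x))) = (\<Sum>J\<in>subsets_s n s. prod d J * (\<Sum>i\<in>J. ?y i))"
    by (simp add: distrib_left sum.distrib sum_gram)
  also have "\<dots> = (\<Sum>J\<in>subsets_s n s. \<Sum>i<n. if i \<in> J then prod d J * ?y i else 0)"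
  proof (rule sum.cong[OF refl])
    fix J assume "J \<in> subsets_s n s"
    hence "{..<n} \<inter> J = J" by (auto simp: subsets_s_def)
    thus "prod d J * (\<Sum>i\<in>J. ?y i) = (\<Sum>i<n. if i \<in> J then prod d J * ?y i else 0)"
      by (simp add: sum.inter_restrict[symmetric] sum_distrib_left)
  qed
  also have "\<dots> = (\<Sum>i<n. \<Sum>J\<in>subsets_s n s. if i \<in> J then prod d J * ?y i else 0)"
    by (rule sum.swap)
  also have "\<dots> = (\<Sum>i<n. (\<Sum>J\<in>{J\<in>subsets_s n s. i \<in> J}. prod d J) * ?y i)"
    unfolding sum_distrib_right by (simp add: sum.inter_filter[OF finite_subsets_s])
  finally show ?thesis
    unfolding vol_prob_eq lam_def by (simp add: sum_divide_distrib[symmetric] divide_simps)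
qed

text \<open>Polarisation: the projections are symmetric, so the quadratic form at
  \<open>?v + z\<close> and \<open>?v - z\<close> determines the mixed term.\<close>

lemma mean_proj:
  assumes i: "i < n" and z: "z \<in> carrier_vec n"
  shows "(\<Sum>S\<in>subsets_s m s. vol_prob A s S * (col V i \<bullet> (proj S *\<^sub>v z))) = lam i * (col V i \<bullet> z)"
proof -
  let ?v = "col V i"
  let ?q = "\<lambda>x. \<Sum>S\<in>subsets_s m s. vol_prob A s S * (x \<bullet> (proj S *\<^sub>v x))"
  have pol: "(?v + z) \<bullet> (proj S *\<^sub>v (?v + z)) - (?v - z) \<bullet> (proj S *\<^sub>v (?v - z))
      = 4 * (?v \<bullet> (proj S *\<^sub>v z))" if S: "S \<in> subsets_s m s" for S
  proof -
    note P = proj_carrier[OF S]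
    have c: "proj S *\<^sub>v ?v \<in> carrier_vec n" "proj S *\<^sub>v z \<in> carrier_vec n"
      using P z by (simp_all only: mult_mat_vec_carrier col_V)
    have "z \<bullet> (proj S *\<^sub>v ?v) = (transpose_mat (proj S) *\<^sub>v z) \<bullet> ?v"
      using transpose_vec_mult_scalar[OF P col_V z] by (simp only:)
    also have "\<dots> = ?v \<bullet> (proj S *\<^sub>v z)" unfolding proj_sym using c by (intro comm_scalar_prod) auto
    finally have sym: "z \<bullet> (proj S *\<^sub>v ?v) = ?v \<bullet> (proj S *\<^sub>v z)" .
    show ?thesis
      unfolding mult_add_distrib_mat_vec[OF P col_V z] mult_minus_distrib_mat_vec[OF P col_V z]
      using c z sym
      by (simp only: add_scalar_prod_distrib[of _ n] minus_scalar_prod_distrib[of _ n] scalar_prod_add_distrib[of _ n]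
        scalar_prod_minus_distrib[of _ n] add_carrier_vec minus_carrier_vec col_V)
  qed
  have "4 * (\<Sum>S\<in>subsets_s m s. vol_prob A s S * (?v \<bullet> (proj S *\<^sub>v z))) = ?q (?v + z) - ?q (?v - z)"
    unfolding sum_distrib_left sum_subtractf[symmetric]
    by (intro sum.cong refl) (simp only: pol[symmetric] algebra_simps)
  also have "\<dots> = (\<Sum>j<n. lam j * ((col V j \<bullet> (?v + z))\<^sup>2 - (col V j \<bullet> (?v - z))\<^sup>2))"
    using z by (simp add: mean_proj_quadratic sum_subtractf[symmetric] right_diff_distrib)
  \<comment> \<open>The difference of squares is four times
    \<open>(col V j \<bullet> ?v) (col V j \<bullet> z)\<close>, which vanishes by orthonormality
    unless \<open>j = i\<close>.\<close>
  also have "\<dots> = (\<Sum>j<n. if j = i then 4 * (lam i * (?v \<bullet> z)) else 0)"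
    using z i by (intro sum.cong refl)
      (auto simp: scalar_prod_add_distrib[of _ n] scalar_prod_minus_distrib[of _ n] col_V_prod power2_eq_square algebra_simps)
  finally show ?thesis using i by simp
qed

section \<open>Bounds on the eigenvalues of the mean projection\<close>

lemma lam_le_1: "lam i \<le> 1"
proof -
  have "(\<Sum>J\<in>{J\<in>subsets_s n s. i \<in> J}. prod d J) \<le> total_weight"
  proof (rule sum_mono2[OF finite_subsets_s])
    fix J assume "J \<in> subsets_s n s - {J\<in>subsets_s n s. i \<in> J}"
    thus "0 \<le> prod d J" using nonneg by (intro prod_nonneg) (auto simp: subsets_s_def)
  qed auto
  thus ?thesis unfolding lam_def using total_pos by simp
qed

lemma rho_le_lam:
  assumes i: "i < mat_rank A"
  shows "rho A s \<le> lam i"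
proof -
  let ?r = "mat_rank A"
  have "d (?r - 1) * total_weight \<le>
      (\<Sum>l = s - 1..<?r. d l) * (\<Sum>J\<in>{J\<in>subsets_s n s. i \<in> J}. prod d J)"
  proof (rule marginal_weight_lower_bound[OF desc _ _ rank_le s1 i])
    show "d j > 0" if "j < ?r" for j using pos[of j] that rank_le by simp
    show "d j = 0" if "?r \<le> j" "j < n" for j using pos[of j] nonneg[of j] that by simp
  qed
  moreover have "(\<Sum>l = s - 1..<?r. d l) > 0"
    using s1 sr rank_le pos by (intro sum_pos) auto
  ultimately show ?thesis
    unfolding rho_def lam_def using total_pos by (simp add: divide_simps mult.commute)
qed

section \<open>The iteration and its mean error\<close>

lemma bk_step_error:
  assumes S: "S \<in> subsets_s m s" and x: "x \<in> carrier_vec n" and y: "y \<in> carrier_vec n"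
    and b: "A *\<^sub>v y = b"
  shows "bk_step A b S x \<in> carrier_vec n"
    and "bk_step A b S x - y = (x - y) - proj S *\<^sub>v (x - y)"
proof -
  have R: "R S \<in> carrier_mat s n" by (rule row_sub_carrier[OF A S])
  have X: "pinv (R S) \<in> carrier_mat n s"
    using is_pinv_pinv[of "R S"] R unfolding is_pinv_def by auto
  \<comment> \<open>As \<open>y\<close> solves the full system, the sampled right-hand side is
    \<open>R S\<close> applied to \<open>y\<close>.\<close>
  have "R S *\<^sub>v x - vec_sub b S = R S *\<^sub>v (x - y)"
    unfolding b[symmetric] vec_sub_mult[OF A S y] using mult_minus_distrib_mat_vec[OF R x y] by simp
  hence step: "bk_step A b S x = x - proj S *\<^sub>v (x - y)"
    unfolding bk_step_def using assoc_mult_mat_vec[OF X R, of "x - y"] x y by simp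
  have c: "proj S *\<^sub>v (x - y) \<in> carrier_vec n"
    using proj_carrier[OF S] x y by (intro mult_mat_vec_carrier[of _ n n]) auto
  show "bk_step A b S x \<in> carrier_vec n" unfolding step using x c by (rule minus_carrier_vec)
  have "x - w - y = x - y - w" if "w \<in> carrier_vec n" for w
    using x y that by (intro eq_vecI) auto
  from this[OF c] show "bk_step A b S x - y = (x - y) - proj S *\<^sub>v (x - y)" unfolding step .
qed

abbreviation "samples k \<equiv> {Ss. length Ss = k \<and> set Ss \<subseteq> subsets_s m s}"

lemma samples_Suc: "samples (Suc k) = (\<lambda>(T, Ss). T # Ss) ` (subsets_s m s \<times> samples k)"
proof (intro subset_antisym subsetI)
  fix Ss assume "Ss \<in> samples (Suc k)"
  thus "Ss \<in> (\<lambda>(T, Ss). T # Ss) ` (subsets_s m s \<times> samples k)" by (cases Ss) auto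
qed auto

text \<open>The head of the sample list is the first step taken, so the induction peels off that
  draw and restarts from the new iterate; hence the start \<open>x\<close> is arbitrary. Averaging
  over the draw gives one more factor \<open>1 - lam i\<close>.\<close>

lemma mean_error_coordinate:
  assumes i: "i < n" and x: "x \<in> carrier_vec n" and y: "y \<in> carrier_vec n" and b: "A *\<^sub>v y = b"
  shows "(\<Sum>Ss\<in>samples k. (\<Prod>T\<leftarrow>Ss. vol_prob A s T) * (col V i \<bullet> (bk_iter A b x Ss - y)))
    = (1 - lam i) ^ k * (col V i \<bullet> (x - y))"
  using x
proof (induction k arbitrary: x)
  case 0
  have "samples 0 = {[]}" by auto
  thus ?case by (simp add: bk_iter_def)
next
  case (Suc k)
  let ?v = "col V i"
  have xy: "x - y \<in> carrier_vec n" using Suc.prems y by simp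
  have inj: "inj_on (\<lambda>(T, Ss). T # Ss) (subsets_s m s \<times> samples k)" by (auto simp: inj_on_def)
  have "(\<Sum>Ss\<in>samples (Suc k). (\<Prod>T\<leftarrow>Ss. vol_prob A s T) * (?v \<bullet> (bk_iter A b x Ss - y)))
      = (\<Sum>(T, Ss)\<in>subsets_s m s \<times> samples k.
          vol_prob A s T * ((\<Prod>T\<leftarrow>Ss. vol_prob A s T) * (?v \<bullet> (bk_iter A b (bk_step A b T x) Ss - y))))"
    unfolding samples_Suc sum.reindex[OF inj] by (intro sum.cong refl) (auto simp: bk_iter_def mult.assoc)
  also have "\<dots> = (\<Sum>T\<in>subsets_s m s. vol_prob A s T *
      (\<Sum>Ss\<in>samples k. (\<Prod>T\<leftarrow>Ss. vol_prob A s T) * (?v \<bullet> (bk_iter A b (bk_step A b T x) Ss - y))))"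
    by (simp add: sum.cartesian_product[symmetric] sum_distrib_left)
  also have "\<dots> = (\<Sum>T\<in>subsets_s m s. vol_prob A s T * ((1 - lam i) ^ k * (?v \<bullet> (x - y) - ?v \<bullet> (proj T *\<^sub>v (x - y)))))"
  proof (rule sum.cong[OF refl])
    fix T assume T: "T \<in> subsets_s m s"
    note step = bk_step_error[OF T Suc.prems y b]
    have c: "proj T *\<^sub>v (x - y) \<in> carrier_vec n"
      using proj_carrier[OF T] xy by (rule mult_mat_vec_carrier)
    show "vol_prob A s T * (\<Sum>Ss\<in>samples k. (\<Prod>T\<leftarrow>Ss. vol_prob A s T) * (?v \<bullet> (bk_iter A b (bk_step A b T x) Ss - y)))
      = vol_prob A s T * ((1 - lam i) ^ k * (?v \<bullet> (x - y) - ?v \<bullet> (proj T *\<^sub>v (x - y))))"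
      unfolding Suc.IH[OF step(1)] step(2) scalar_prod_minus_distrib[OF col_V xy c] ..
  qed
  also have "\<dots> = (1 - lam i) ^ k * ((\<Sum>T\<in>subsets_s m s. vol_prob A s T) * (?v \<bullet> (x - y))
      - (\<Sum>T\<in>subsets_s m s. vol_prob A s T * (?v \<bullet> (proj T *\<^sub>v (x - y)))))"
    unfolding sum_distrib_right sum_distrib_left sum_subtractf[symmetric]
    by (intro sum.cong refl) (simp only: algebra_simps)
  also have "\<dots> = (1 - lam i) ^ Suc k * (?v \<bullet> (x - y))"
    unfolding sum_vol_prob mean_proj[OF i xy] by (simp add: algebra_simps)
  finally show ?case .
qed

text \<open>The expectation is defined entrywise; interchanging the two sums moves the inner product
  inside it.\<close>

lemma expected_err_coordinate:
  assumes i: "i < n" and x: "x \<in> carrier_vec n" and y: "y \<in> carrier_vec n" and b: "A *\<^sub>v y = b"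
  shows "col V i \<bullet> expected_err A b s x k y = (1 - lam i) ^ k * (col V i \<bullet> (x - y))"
proof -
  have "col V i \<bullet> expected_err A b s x k y
      = (\<Sum>j<n. \<Sum>Ss\<in>samples k. (\<Prod>T\<leftarrow>Ss. vol_prob A s T) * (col V i $ j * (bk_iter A b x Ss - y) $ j))"
    using x A by (simp add: scalar_prod_def expected_err_def atLeast0LessThan sum_distrib_left mult_ac)
  also have "\<dots> = (\<Sum>Ss\<in>samples k. (\<Prod>T\<leftarrow>Ss. vol_prob A s T) * (col V i \<bullet> (bk_iter A b x Ss - y)))"
    using y by (subst sum.swap) (simp add: scalar_prod_def atLeast0LessThan sum_distrib_left)
  finally show ?thesis using mean_error_coordinate[OF assms] by simp
qed

lemma expected_err_bound:
  assumes x: "x \<in> carrier_vec n" and y: "y \<in> carrier_vec n" and b: "A *\<^sub>v y = b"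
    and row_space: "\<And>i. i < n \<Longrightarrow> A *\<^sub>v col V i = 0\<^sub>v m \<Longrightarrow> col V i \<bullet> (x - y) = 0"
  shows "expected_err A b s x k y \<bullet> expected_err A b s x k y
    \<le> (1 - rho A s) ^ (2 * k) * ((x - y) \<bullet> (x - y))"
proof -
  have e: "expected_err A b s x k y \<in> carrier_vec n" using x by (auto simp: expected_err_def)
  have xy: "x - y \<in> carrier_vec n" using x y by simp
  have "expected_err A b s x k y \<bullet> expected_err A b s x k y
      = (\<Sum>i<n. (1 - lam i) ^ (2 * k) * (col V i \<bullet> (x - y))\<^sup>2)"
    unfolding parseval[OF e]
    by (intro sum.cong refl)
      (simp add: expected_err_coordinate[OF _ x y b] power_mult_distrib power_mult[symmetric] mult.commute)
  also have "\<dots> \<le> (\<Sum>i<n. (1 - rho A s) ^ (2 * k) * (col V i \<bullet> (x - y))\<^sup>2)"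
  proof (rule sum_mono)
    fix i assume "i \<in> {..<n}"
    hence i: "i < n" by simp
    show "(1 - lam i) ^ (2 * k) * (col V i \<bullet> (x - y))\<^sup>2 \<le> (1 - rho A s) ^ (2 * k) * (col V i \<bullet> (x - y))\<^sup>2"
    proof (cases "i < mat_rank A")
      case True
      \<comment> \<open>\<open>lam_le_1\<close> keeps the base \<open>1 - lam i\<close> nonnegative,
        as monotonicity of powers demands.\<close>
      thus ?thesis using rho_le_lam[OF True] lam_le_1[of i] by (intro mult_right_mono power_mono) auto
    next
      case False
      \<comment> \<open>Beyond the rank \<open>col V i\<close> lies in the kernel of
        \<open>A\<close>; there the error has no component, so no bound on \<open>lam i\<close> is
        required.\<close>
      hence "d i = 0" using pos[OF i] nonneg[OF i] by simp
      hence "col (A * V) i \<bullet> col (A * V) i = 0" using orth[OF i i] by simp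
      moreover have "col (A * V) i = A *\<^sub>v col V i" by (rule col_mult2[OF A V i])
      moreover have "A *\<^sub>v col V i \<in> carrier_vec m" using A col_V by (rule mult_mat_vec_carrier)
      ultimately have "A *\<^sub>v col V i = 0\<^sub>v m" using real_scalar_prod_self_eq_0_iff by metis
      thus ?thesis using row_space[OF i] by simp
    qed
  qed
  also have "\<dots> = (1 - rho A s) ^ (2 * k) * ((x - y) \<bullet> (x - y))"
    unfolding parseval[OF xy] sum_distrib_left ..
  finally show ?thesis .
qed

end

section \<open>The reference point and the row space\<close>

theorem theorem3p2:
  fixes A :: "real mat" and b x0 :: "real vec" and m n s k :: nat
  assumes "A \<in> carrier_mat m n" and "b \<in> carrier_vec m" and "x0 \<in> carrier_vec n"
    and "\<exists>x \<in> carrier_vec n. A *\<^sub>v x = b"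
    and "1 \<le> s" and "s \<le> mat_rank A"
  shows "(let xs = pinv A *\<^sub>v b + (1\<^sub>m n - pinv A * A) *\<^sub>v x0;
              e = expected_err A b s x0 k xs
          in e \<bullet> e \<le> (1 - rho A s) ^ (2 * k) * ((x0 - xs) \<bullet> (x0 - xs)))"
proof -
  note A = assms(1) and b = assms(2) and x0 = assms(3)
  obtain V where "volume_sampling A V m n s"
    by (rule ex_right_singular_basis[OF A], rule that) (intro volume_sampling.intro A assms(5,6))
  then interpret volume_sampling A V m n s .
  let ?X = "pinv A"
  from is_pinv_pinv[of A] A have X: "?X \<in> carrier_mat n m" and AXA: "A * ?X * A = A"
    and sym: "transpose_mat (?X * A) = ?X * A"
    unfolding is_pinv_def by auto
  have XA: "?X * A \<in> carrier_mat n n" using X A by simp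
  from assms(4) obtain z where z: "z \<in> carrier_vec n" and Az: "A *\<^sub>v z = b" by auto
  define xs where "xs = ?X *\<^sub>v b + (1\<^sub>m n - ?X * A) *\<^sub>v x0"
  have Xb: "?X *\<^sub>v b = (?X * A) *\<^sub>v z" unfolding Az[symmetric] using X A z by simp
  have xs_eq: "xs = (?X * A) *\<^sub>v z + (x0 - (?X * A) *\<^sub>v x0)"
    unfolding xs_def Xb using minus_mult_distrib_mat_vec[OF one_carrier_mat XA x0] x0 by simp
  have c: "(?X * A) *\<^sub>v z \<in> carrier_vec n" "(?X * A) *\<^sub>v x0 \<in> carrier_vec n"
    using XA z x0 by (simp_all only: mult_mat_vec_carrier)
  have xs: "xs \<in> carrier_vec n" unfolding xs_eq using c x0 by simp
  \<comment> \<open>Projecting onto the row space does not change the image under \<open>A\<close>;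
    this makes \<open>xs\<close> a solution.\<close>
  have AXAv: "A *\<^sub>v ((?X * A) *\<^sub>v w) = A *\<^sub>v w" if w: "w \<in> carrier_vec n" for w
  proof -
    have "A *\<^sub>v ((?X * A) *\<^sub>v w) = (A * (?X * A)) *\<^sub>v w"
      by (rule assoc_mult_mat_vec[OF A XA w, symmetric])
    also have "A * (?X * A) = A" using assoc_mult_mat[OF A X A] AXA by simp
    finally show ?thesis .
  qed
  have Axs: "A *\<^sub>v xs = b"
  proof -
    have "A *\<^sub>v xs = A *\<^sub>v ((?X * A) *\<^sub>v z) + (A *\<^sub>v x0 - A *\<^sub>v ((?X * A) *\<^sub>v x0))"
      unfolding xs_eq
      by (subst mult_add_distrib_mat_vec[OF A c(1)], use x0 c in simp,
          subst mult_minus_distrib_mat_vec[OF A x0 c(2)], rule refl)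
    moreover have "b + (w - w) = b" if "w \<in> carrier_vec m" for w
      using b that by (intro eq_vecI) auto
    ultimately show ?thesis unfolding AXAv[OF z] AXAv[OF x0] Az using A x0 by simp
  qed
  have "x0 - (p + (x0 - q)) = q - p" if "p \<in> carrier_vec n" "q \<in> carrier_vec n" for p q
    using x0 that by (intro eq_vecI) auto
  \<comment> \<open>The initial error is the projection of \<open>x0 - z\<close> onto the row space,
    for any solution \<open>z\<close>.\<close>
  from this[OF c] have diff: "x0 - xs = (?X * A) *\<^sub>v (x0 - z)"
    unfolding mult_minus_distrib_mat_vec[OF XA x0 z] xs_eq .
  have "col V i \<bullet> (x0 - xs) = 0" if Av: "A *\<^sub>v col V i = 0\<^sub>v m" for i
  proof -
    \<comment> \<open>The symmetric projection moves to the other factor, where it annihilates the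
      kernel vector.\<close>
    have "col V i \<bullet> (x0 - xs) = (transpose_mat (?X * A) *\<^sub>v col V i) \<bullet> (x0 - z)"
      unfolding diff using transpose_vec_mult_scalar[OF XA _ col_V] x0 z by simp
    also have "transpose_mat (?X * A) *\<^sub>v col V i = ?X *\<^sub>v (A *\<^sub>v col V i)"
      unfolding sym by (rule assoc_mult_mat_vec[OF X A col_V])
    also have "\<dots> = 0\<^sub>v n" unfolding Av using X by (intro eq_vecI) auto
    finally show ?thesis using x0 z by simp
  qed
  from expected_err_bound[OF x0 xs Axs this] show ?thesis unfolding xs_def Let_def .
qed

end
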